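(* Let $(X,d)$ be a Polish metric space, $1<p<\infty$, $E:\mathcal P_p(X)\to(-\infty,+\infty]$ proper and $G:\mathcal P_p(X)\to[0,+\infty]$ a weak upper gradient for $E$, satisfying (A1), (A3) and either (A2) or (A2'). Assume that for every $\rho_0\in Z_{E,p}$ there exists a $p$-curve of maximal slope $\rho\in AC([0,\infty);\mathcal P_p(X))$ of $E$ with respect to $G$ with $\rho(0)=\rho_0$. Then for any such curve $\rho$, $$\lim_{t\to\infty}d_\sigma(\rho(t),\mathcal E)=\lim_{t\to\infty}\inf_{\mu\in\mathcal E}d_\sigma(\rho(t),\mu)=0.$$ Furthermore, if (A2') is satisfied with a set $\mathcal Y$ that is closed in the $\sigma$-topology on $\mathcal P_p(X)$, then $\lim_{t\to\infty}d_\sigma(\rho(t),\mathcal E\cap\mathcal Y)=0$.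
   Context: $\mathcal P(X)$: Borel probability measures on $X$ with the narrow topology, metrised by the Lévy–Prokhorov metric $d_{LP}$. $\mathcal P_p(X)$: measures with finite $p$-th moment, with the $p$-Wasserstein distance $W_p$. The $\sigma$-topology on $\mathcal P_p(X)$ is the narrow topology restricted to $\mathcal P_p(X)$, metrised by $d_\sigma$, the restriction of $d_{LP}$. $q=p/(p-1)$. $\rho\in AC([0,\infty);\mathcal P_p(X))$ means: for each $T>0$ there is $m\in L^1([0,T])$ with $W_p(\rho(t),\rho(s))\le\int_s^tm$ for $0\le s<t\le T$; metric derivative $|\rho'|(t)=\lim_{s\to t}W_p(\rho(t),\rho(s))/|t-s|$ (exists a.e.). $G$ is a weak upper gradient for $E$ if for every absolutely continuous curve $\rho$ on $[0,T]$ with $(G\circ\rho)|\rho'|\in L^1([0,T])$, $E\circ\rho$ is a.e. equal to a function $\varphi$ of finite pointwise variation with $|\varphi'|\le G(\rho)|\rho'|$ a.e. A $p$-curve of maximal slope for $E$ w.r.t. $G$ is $\rho\in AC([0,\infty);\mathcal P_p(X))$ with $E\circ\rho$ a.e. equal to a non-increasing $\varphi$ satisfying $\varphi'(t)=-\frac1p|\rho'|^p(t)-\frac1qG^q(\rho(t))$ for a.e. $t$. $Z_{E,p}=\{\rho\in\mathcal P_p(X):E(\rho)<\infty\}$. A stationary state is $\mu\in\mathcal P_p(X)$ with $E(\mu)<\infty$ such that the constant curve $\equiv\mu$ is a $p$-curve of maximal slope; $\mathcal E$ is the set of stationary states. $d_\sigma(\mu,A)=\inf_{\nu\in A}d_\sigma(\mu,\nu)$.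 (A1) $E$ proper, bounded below, l.s.c. w.r.t. the $\sigma$-topology. (A2) For every $C\in\mathbb R$, $\{\mu\in\mathcal P_p(X):E(\mu)\le C\}$ is relatively compact in the $\sigma$-topology. (A2') There is $\mathcal Y\subset\mathcal P_p(X)$ containing $\rho(t)$ for all $t\ge0$ such that $\{\mu\in\mathcal P_p(X)\cap\mathcal Y:E(\mu)\le C\}$ is relatively compact in the $\sigma$-topology for every $C$. (A3) $G$ l.s.c. w.r.t. the $\sigma$-topology. *)

theory Defs
  imports "HOL-Probability.Probability"
begin

definition Prob :: "'a::polish_space measure set" where
  "Prob = {\<mu>. sets \<mu> = sets borel \<and> prob_space \<mu>}"

definition Pp :: "real \<Rightarrow> 'a::polish_space measure set" where
  "Pp p = {\<mu> \<in> Prob. \<exists>x0. (\<integral>\<^sup>+ x. ennreal (dist x x0 powr p) \<partial>\<mu>) < \<infinity>}"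

definition enlarge :: "'a::metric_space set \<Rightarrow> real \<Rightarrow> 'a set" where
  "enlarge A e = {x. \<exists>y\<in>A. dist x y < e}"

text \<open>Levy--Prokhorov metric (d_sigma is its restriction to Pp).\<close>
definition dLP :: "'a::polish_space measure \<Rightarrow> 'a measure \<Rightarrow> real" where
  "dLP \<mu> \<nu> = Inf {e. e > 0 \<and> (\<forall>A \<in> sets borel.
      measure \<mu> A \<le> measure \<nu> (enlarge A e) + e \<and>
      measure \<nu> A \<le> measure \<mu> (enlarge A e) + e)}"

text \<open>Distance from a measure to a set of measures (inf of the empty set is +infinity).\<close>
definition dLP_set :: "'a::polish_space measure \<Rightarrow> 'a measure set \<Rightarrow> ennreal" where
  "dLP_set \<mu> A = (INF \<nu>\<in>A. ennreal (dLP \<mu> \<nu>))"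

definition couplings :: "'a::polish_space measure \<Rightarrow> 'a measure \<Rightarrow> ('a \<times> 'a) measure set" where
  "couplings \<mu> \<nu> = {\<pi>. sets \<pi> = sets borel \<and> prob_space \<pi> \<and>
      distr \<pi> borel fst = \<mu> \<and> distr \<pi> borel snd = \<nu>}"

definition Wp :: "real \<Rightarrow> 'a::polish_space measure \<Rightarrow> 'a measure \<Rightarrow> real" where
  "Wp p \<mu> \<nu> = (enn2real (INF \<pi>\<in>couplings \<mu> \<nu>.
      \<integral>\<^sup>+ z. ennreal (dist (fst z) (snd z) powr p) \<partial>\<pi>)) powr (1 / p)"

definition ACT :: "real \<Rightarrow> real \<Rightarrow> (real \<Rightarrow> 'a::polish_space measure) \<Rightarrow> bool" where
  "ACT p T \<rho> \<longleftrightarrow> (\<forall>t\<in>{0..T}. \<rho> t \<in> Pp p) \<and>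
     (\<exists>m. set_integrable lborel {0..T} m \<and>
        (\<forall>s t. 0 \<le> s \<and> s < t \<and> t \<le> T \<longrightarrow>
           Wp p (\<rho> t) (\<rho> s) \<le> (LINT r:{s..t}|lborel. m r)))"

definition AC :: "real \<Rightarrow> (real \<Rightarrow> 'a::polish_space measure) \<Rightarrow> bool" where
  "AC p \<rho> \<longleftrightarrow> (\<forall>t\<ge>0. \<rho> t \<in> Pp p) \<and> (\<forall>T>0. ACT p T \<rho>)"

text \<open>Metric derivative (the limit exists almost everywhere for AC curves;
  its value elsewhere is irrelevant since it is only used almost everywhere).\<close>
definition metric_deriv :: "real \<Rightarrow> (real \<Rightarrow> 'a::polish_space measure) \<Rightarrow> real \<Rightarrow> real" where
  "metric_deriv p \<rho> t = Lim (at t within {0..}) (\<lambda>s. Wp p (\<rho> t) (\<rho> s) / \<bar>t - s\<bar>)"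

definition finite_pvar :: "(real \<Rightarrow> real) \<Rightarrow> real \<Rightarrow> real \<Rightarrow> bool" where
  "finite_pvar \<phi> a b \<longleftrightarrow> (\<exists>B. \<forall>n (t::nat \<Rightarrow> real).
      a \<le> t 0 \<and> t n \<le> b \<and> (\<forall>i<n. t i \<le> t (Suc i)) \<longrightarrow>
      (\<Sum>i<n. \<bar>\<phi> (t (Suc i)) - \<phi> (t i)\<bar>) \<le> B)"

definition weak_upper_gradient ::
  "real \<Rightarrow> ('a::polish_space measure \<Rightarrow> ereal) \<Rightarrow> ('a measure \<Rightarrow> ennreal) \<Rightarrow> bool" where
  "weak_upper_gradient p E G \<longleftrightarrow>
    (\<forall>T>0. \<forall>\<rho>. ACT p T \<rho> \<and>
       (\<lambda>t. indicator {0..T} t * G (\<rho> t) * ennreal (metric_deriv p \<rho> t)) \<in> borel_measurable lborel \<and>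
       (\<integral>\<^sup>+ t. indicator {0..T} t * G (\<rho> t) * ennreal (metric_deriv p \<rho> t) \<partial>lborel) < \<infinity>
     \<longrightarrow> (\<exists>\<phi>. (AE t in lborel. t \<in> {0..T} \<longrightarrow> E (\<rho> t) = ereal (\<phi> t)) \<and>
              finite_pvar \<phi> 0 T \<and>
              (AE t in lborel. t \<in> {0..T} \<longrightarrow>
                 (\<exists>D. (\<phi> has_real_derivative D) (at t within {0..T}) \<and>
                      ennreal \<bar>D\<bar> \<le> G (\<rho> t) * ennreal (metric_deriv p \<rho> t)))))"

definition max_slope_curve ::
  "real \<Rightarrow> ('a::polish_space measure \<Rightarrow> ereal) \<Rightarrow> ('a measure \<Rightarrow> ennreal) \<Rightarrow> (real \<Rightarrow> 'a measure) \<Rightarrow> bool" where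
  "max_slope_curve p E G \<rho> \<longleftrightarrow> AC p \<rho> \<and>
    (\<exists>\<phi> :: real \<Rightarrow> ereal.
       (AE t in lborel. t \<ge> 0 \<longrightarrow> E (\<rho> t) = \<phi> t) \<and>
       antimono_on {0..} \<phi> \<and>
       (AE t in lborel. t \<ge> 0 \<longrightarrow>
          \<phi> t \<noteq> \<infinity> \<and> G (\<rho> t) < \<infinity> \<and>
          ((\<lambda>s. real_of_ereal (\<phi> s)) has_real_derivative
             (- (1 / p) * metric_deriv p \<rho> t powr p
              - (1 / (p / (p - 1))) * enn2real (G (\<rho> t)) powr (p / (p - 1)))) (at t within {0..})))"

definition ZE :: "real \<Rightarrow> ('a::polish_space measure \<Rightarrow> ereal) \<Rightarrow> 'a measure set" where
  "ZE p E = {\<mu> \<in> Pp p. E \<mu> < \<infinity>}"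

definition stationary :: "real \<Rightarrow> ('a::polish_space measure \<Rightarrow> ereal) \<Rightarrow> ('a measure \<Rightarrow> ennreal) \<Rightarrow> 'a measure set" where
  "stationary p E G = {\<mu> \<in> Pp p. E \<mu> < \<infinity> \<and> max_slope_curve p E G (\<lambda>_. \<mu>)}"

section \<open>Sigma-topology notions on Pp (metrised by dLP)\<close>

definition lsc_sigma :: "real \<Rightarrow> ('a::polish_space measure \<Rightarrow> 'b::complete_linorder) \<Rightarrow> bool" where
  "lsc_sigma p F \<longleftrightarrow> (\<forall>\<mu>\<in>Pp p. \<forall>s. (\<forall>n. s n \<in> Pp p) \<and> (\<lambda>n. dLP (s n) \<mu>) \<longlonglongrightarrow> 0
       \<longrightarrow> F \<mu> \<le> liminf (\<lambda>n. F (s n)))"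

definition rel_compact_sigma :: "real \<Rightarrow> 'a::polish_space measure set \<Rightarrow> bool" where
  "rel_compact_sigma p A \<longleftrightarrow> A \<subseteq> Pp p \<and> (\<forall>s::nat \<Rightarrow> 'a measure. (\<forall>n. s n \<in> A) \<longrightarrow>
     (\<exists>l\<in>Pp p. \<exists>r::nat \<Rightarrow> nat. strict_mono r \<and> (\<lambda>n. dLP (s (r n)) l) \<longlonglongrightarrow> 0))"

definition closed_sigma :: "real \<Rightarrow> 'a::polish_space measure set \<Rightarrow> bool" where
  "closed_sigma p Y \<longleftrightarrow> (\<forall>s l. (\<forall>n. s n \<in> Y \<inter> Pp p) \<and> l \<in> Pp p \<and> (\<lambda>n. dLP (s n) l) \<longlonglongrightarrow> 0
       \<longrightarrow> l \<in> Y)"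

end

theory Submission
  imports Defs
begin

text \<open>Along a curve of maximal slope the energy is non-increasing and bounded below, so its drop over
  \<open>[t, t + 1]\<close> tends to \<open>0\<close> as \<open>t \<rightarrow> \<infinity>\<close>. This drop dominates \<open>\<integral> |\<rho>'|\<^sup>p / p + G(\<rho>)\<^sup>q / q\<close>; hence the curve
  moves less and less in \<open>W\<^sub>p\<close>, and every unit interval contains times at which the slope is small.
  If \<open>\<rho>(t\<^sub>n)\<close> converges to \<open>l\<close> for some \<open>t\<^sub>n \<rightarrow> \<infinity>\<close>, there are therefore nearby times \<open>s\<^sub>n\<close> with
  \<open>\<rho>(s\<^sub>n) \<rightarrow> l\<close> and \<open>G(\<rho>(s\<^sub>n)) \<rightarrow> 0\<close>, so that \<open>G(l) = 0\<close> by lower semicontinuity and \<open>l\<close> is stationary.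
  Compactness of the energy sublevels turns this into convergence to the set of stationary states.\<close>

section \<open>Metric derivatives of curves of bounded variation\<close>

text \<open>What shapes the proof is how little regularity a curve of maximal slope brings along.
  \<open>metric_deriv\<close> is a \<open>Lim\<close>, which says nothing where no limit exists, so
  the slope equation controls the motion only once the difference quotients are known to converge
  almost everywhere; hence a differentiation theorem for curves of bounded variation. The function
  \<phi> is monotone, perhaps not absolutely continuous, so its equation cannot be integrated as an
  identity. One-sided estimates suffice, since singular drops of the energy only help, and they come
  from one principle, \<open>subadditive_AE_bound\<close>: a subadditive interval function dominated
  by the integral of an integrable function is controlled by its derivative almost everywhere.
  Applied to the motion, this rests on the triangle inequality for \<open>Wp\<close>, that is, on
  gluing couplings. Also E(\<rho>(t)) = \<phi>(t) holds only almost everywhere, while compactness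
  needs an energy bound at every late time; lower semicontinuity of E bridges the gap. Finally, a
  limit of finite energy and zero slope is stationary because a constant curve has zero speed, so
  that the slope equation reads 0 = 0.\<close>

lemma superadditive_sum_le:
  fixes W :: "real \<Rightarrow> real \<Rightarrow> real"
  assumes nonneg: "\<And>u w. \<lbrakk>a \<le> u; u \<le> w; w \<le> b\<rbrakk> \<Longrightarrow> 0 \<le> W u w"
    and super: "\<And>u x w. \<lbrakk>a \<le> u; u \<le> x; x \<le> w; w \<le> b\<rbrakk> \<Longrightarrow> W u x + W x w \<le> W u w"
    and "finite C"
    and C: "\<And>u w. (u, w) \<in> C \<Longrightarrow> a \<le> u \<and> u \<le> w \<and> w \<le> b"
    and disj: "pairwise (\<lambda>i j. disjnt {fst i..snd i} {fst j..snd j}) C"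
    and "a \<le> b"
  shows "(\<Sum>(u, w)\<in>C. W u w) \<le> W a b"
  using assms
proof (induction "card C" arbitrary: C b)
  case 0
  then show ?case by simp
next
  case (Suc n)
  have ne: "C \<noteq> {}" using Suc.hyps(2) by auto
  \<comment> \<open>Peel off the interval with the largest left end point. Every other interval
    starts no later and is disjoint from it, so it ends before \<open>m\<close>; the induction
    hypothesis then applies on \<open>{a..m}\<close>, which is why \<open>b\<close> is
    generalised.\<close>
  define m where "m = Max (fst ` C)"
  have "m \<in> fst ` C" unfolding m_def using ne Suc.prems(3) by (intro Max_in) auto
  then obtain w where mw: "(m, w) \<in> C" by auto
  have mx: "u \<le> m" if "(u, v) \<in> C" for u v
    unfolding m_def using that Suc.prems(3) by (intro Max_ge) (auto simp: rev_image_eqI)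
  have b: "a \<le> m" "m \<le> w" "w \<le> b" using Suc.prems(4)[OF mw] by auto
  have below: "v \<le> m" if uv: "(u, v) \<in> C - {(m, w)}" for u v
  proof -
    have "disjnt {u..v} {m..w}"
      using Suc.prems(5) uv mw unfolding pairwise_def by fastforce
    moreover have "u \<le> m" using mx uv by auto
    ultimately show ?thesis using b unfolding disjnt_def
      by (metis Int_iff atLeastAtMost_iff empty_iff linear order_refl)
  qed
  have "(\<Sum>(u, w)\<in>C - {(m, w)}. W u w) \<le> W a m"
  proof (rule Suc.hyps(1))
    show "n = card (C - {(m, w)})" using Suc.hyps(2) mw by simp
    show "finite (C - {(m, w)})" using Suc.prems(3) by simp
    show "a \<le> u \<and> u \<le> v \<and> v \<le> m" if "(u, v) \<in> C - {(m, w)}" for u v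
      using below[OF that] Suc.prems(4) that by auto
    show "pairwise (\<lambda>i j. disjnt {fst i..snd i} {fst j..snd j}) (C - {(m, w)})"
      using Suc.prems(5) by (rule pairwise_mono) auto
  qed (use b Suc.prems(1,2) in auto)
  moreover have "(\<Sum>(u, w)\<in>C. W u w) = W m w + (\<Sum>(u, w)\<in>C - {(m, w)}. W u w)"
    using sum.remove[OF Suc.prems(3) mw, of "\<lambda>(u, w). W u w"] by simp
  moreover have "W a m + W m w \<le> W a w" "W a w + W w b \<le> W a b" "0 \<le> W w b"
    using b Suc.prems(1,2) by auto
  ultimately show ?case by linarith
qed

text \<open>An interval is the closed ball about its midpoint. The covering theorem lets
  \<open>x\<close> sit anywhere in the ball, so intervals having \<open>x\<close> as an end point
  are admissible.\<close>

lemma Vitali_cover_intervals: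
  fixes S :: "real set" and K :: "(real \<times> real) set"
  assumes S: "\<And>x e. \<lbrakk>x \<in> S; 0 < e\<rbrakk> \<Longrightarrow> \<exists>u w. (u, w) \<in> K \<and> u \<le> x \<and> x \<le> w \<and> w - u < e"
    and K: "\<And>u w. (u, w) \<in> K \<Longrightarrow> u < w"
  obtains C where "countable C" "C \<subseteq> K"
    "pairwise (\<lambda>i j. disjnt {fst i..snd i} {fst j..snd j}) C"
    "negligible (S - (\<Union>i\<in>C. {fst i..snd i}))"
proof -
  have eq: "cball ((fst i + snd i) / 2) ((snd i - fst i) / 2) = {fst i..snd i}" for i :: "real \<times> real"
    by (auto simp: cball_eq_atLeastAtMost field_simps)
  show ?thesis
  proof (rule Vitali_covering_theorem_cballs[of K "\<lambda>i. (snd i - fst i) / 2" S "\<lambda>i. (fst i + snd i) / 2"])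
    show "0 < (snd i - fst i) / 2" if "i \<in> K" for i using K[of "fst i" "snd i"] that by simp
    show "\<exists>i. i \<in> K \<and> x \<in> cball ((fst i + snd i) / 2) ((snd i - fst i) / 2) \<and> (snd i - fst i) / 2 < d"
      if xd: "x \<in> S" "0 < d" for x d
    proof -
      obtain u w where "(u, w) \<in> K" "u \<le> x" "x \<le> w" "w - u < d" using S[OF xd] by blast
      then show ?thesis unfolding eq using xd(2) by (intro exI[of _ "(u, w)"]) auto
    qed
  qed (use that[unfolded eq[symmetric]] in blast)
qed

text \<open>Disjoint intervals chosen from the Vitali cover have length below
  \<open>W u w / c\<close>, and superadditivity adds these values up to at most
  \<open>W a b / c\<close>. As \<open>S\<close> is not known to be measurable, its outer measure is
  bounded through a measurable cover \<open>B\<close>.\<close>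

lemma superadditive_Vitali_bound:
  fixes W :: "real \<Rightarrow> real \<Rightarrow> real"
  assumes nonneg: "\<And>u w. \<lbrakk>a \<le> u; u \<le> w; w \<le> b\<rbrakk> \<Longrightarrow> 0 \<le> W u w"
    and super: "\<And>u x w. \<lbrakk>a \<le> u; u \<le> x; x \<le> w; w \<le> b\<rbrakk> \<Longrightarrow> W u x + W x w \<le> W u w"
    and "a \<le> b" "0 < c"
    and S: "\<And>x e. \<lbrakk>x \<in> S; 0 < e\<rbrakk> \<Longrightarrow>
      \<exists>u w. a \<le> u \<and> u \<le> x \<and> x \<le> w \<and> w \<le> b \<and> u < w \<and> w - u < e \<and> c * (w - u) < W u w"
  obtains B where "B \<in> lmeasurable" "S \<subseteq> B" "measure lebesgue B \<le> W a b / c"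
proof -
  define K where "K = {(u, w). a \<le> u \<and> u < w \<and> w \<le> b \<and> c * (w - u) < W u w}"
  obtain C where C: "countable C" "C \<subseteq> K"
    "pairwise (\<lambda>i j. disjnt {fst i..snd i} {fst j..snd j}) C"
    "negligible (S - (\<Union>i\<in>C. {fst i..snd i}))"
  proof (rule Vitali_cover_intervals[of S K])
    show "\<exists>u w. (u, w) \<in> K \<and> u \<le> x \<and> x \<le> w \<and> w - u < e" if "x \<in> S" "0 < e" for x e
      using S[OF that] unfolding K_def by blast
  qed (auto simp: K_def)
  define B where "B = (\<Union>i\<in>C. {fst i..snd i})"
  have bound: "measure lebesgue (\<Union>i\<in>C'. {fst i..snd i}) \<le> W a b / c"
    if C': "C' \<subseteq> C" "finite C'" for C'
  proof -
    have "measure lebesgue (\<Union>i\<in>C'. {fst i..snd i}) \<le> (\<Sum>i\<in>C'. measure lebesgue {fst i..snd i})"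
      using C' by (intro measure_UNION_le) auto
    also have "\<dots> \<le> (\<Sum>(u, w)\<in>C'. W u w / c)"
      using C C' \<open>0 < c\<close> by (intro sum_mono) (auto simp: K_def field_simps)
    also have "\<dots> = (\<Sum>(u, w)\<in>C'. W u w) / c"
      by (simp add: sum_divide_distrib case_prod_unfold)
    also have "\<dots> \<le> W a b / c"
      using C C' \<open>0 < c\<close> \<open>a \<le> b\<close> nonneg super
      by (intro divide_right_mono superadditive_sum_le)
         (auto simp: K_def elim!: pairwise_subset)
    finally show ?thesis .
  qed
  have "B \<in> lmeasurable" unfolding B_def
    by (rule fmeasurable_UN_bound[OF C(1) _ bound]) auto
  moreover have "measure lebesgue B \<le> W a b / c" unfolding B_def
    by (rule measure_UN_bound[OF C(1) _ bound]) auto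
  moreover have N: "S - B \<in> null_sets lebesgue"
    using C(4) unfolding B_def negligible_iff_null_sets .
  ultimately have "B \<union> (S - B) \<in> lmeasurable" "measure lebesgue (B \<union> (S - B)) \<le> W a b / c"
    by (auto simp only: measure_Un_null_set fmeasurable.Un fmeasurableI_null_sets fmeasurableD)
  then show ?thesis using that[of "B \<union> (S - B)"] by blast
qed

section \<open>The total variation of a pseudometric along an interval\<close>

text \<open>The variation sums over partitions, generated by appending a last cell. Refining and
  concatenating partitions become rule inductions, without indexing the partition points.\<close>

inductive psum :: "(real \<Rightarrow> real \<Rightarrow> real) \<Rightarrow> real \<Rightarrow> real \<Rightarrow> real \<Rightarrow> bool" for d a where
  base: "a \<le> b \<Longrightarrow> psum d a b (d a b)"
| step: "psum d a b x \<Longrightarrow> b \<le> c \<Longrightarrow> psum d a c (x + d b c)"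

definition total_var :: "(real \<Rightarrow> real \<Rightarrow> real) \<Rightarrow> real \<Rightarrow> real \<Rightarrow> real" where
  "total_var d a b = Sup {x. psum d a b x}"

lemma psum_le: "psum d a b x \<Longrightarrow> a \<le> b"
  by (induction rule: psum.induct) auto

lemma psum_append: "psum d b c y \<Longrightarrow> psum d a b x \<Longrightarrow> psum d a c (x + y)"
proof (induction rule: psum.induct)
  case (base c)
  then show ?case by (rule psum.step[rotated])
next
  case (step c y e)
  then show ?case using psum.step[of d a c "x + y" e] by (simp add: add.assoc)
qed

text \<open>To be used with the distance of two points of a curve. The increments of
  \<open>F\<close> telescope over a partition, so all variation sums are bounded and their supremum
  is meaningful.\<close>

locale bv_pseudometric =
  fixes d :: "real \<Rightarrow> real \<Rightarrow> real" and F :: "real \<Rightarrow> real" and a b :: real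
  assumes ab: "a \<le> b"
    and nonneg: "\<And>s t. 0 \<le> d s t"
    and sym: "\<And>s t. d s t = d t s"
    and tri: "\<And>s t u. \<lbrakk>a \<le> s; s \<le> t; t \<le> u; u \<le> b\<rbrakk> \<Longrightarrow> d s u \<le> d s t + d t u"
    and F: "\<And>s t. \<lbrakk>a \<le> s; s \<le> t; t \<le> b\<rbrakk> \<Longrightarrow> d s t \<le> F t - F s"
begin

abbreviation "V \<equiv> total_var d"

lemma psum_bound: "psum d s t x \<Longrightarrow> a \<le> s \<Longrightarrow> t \<le> b \<Longrightarrow> x \<le> F t - F s"
proof (induction rule: psum.induct)
  case (base t) then show ?case using F by auto
next
  case (step t x u)
  then have "s \<le> t" by (auto dest: psum_le)
  then show ?case using step F[of t u] by auto
qed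

lemma psum_le_V: "psum d s t x \<Longrightarrow> a \<le> s \<Longrightarrow> t \<le> b \<Longrightarrow> x \<le> V s t"
  unfolding total_var_def
  by (rule cSup_upper) (auto intro!: bdd_aboveI[of _ "F t - F s"] psum_bound)

lemma d_le_V: "\<lbrakk>a \<le> s; s \<le> t; t \<le> b\<rbrakk> \<Longrightarrow> d s t \<le> V s t"
  by (intro psum_le_V psum.base)

lemma V_approx:
  assumes "s \<le> t" "0 < e"
  obtains x where "psum d s t x" "V s t - e < x"
proof -
  have "\<exists>x\<in>{x. psum d s t x}. V s t - e < x"
    using assms unfolding total_var_def
    by (intro less_cSupD) (auto intro: psum.base)
  then show ?thesis using that by auto
qed

text \<open>By the triangle inequality, inserting \<open>t\<close> into a partition can only
  increase its sum.\<close>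

lemma psum_split:
  "psum d s u x \<Longrightarrow> a \<le> s \<Longrightarrow> u \<le> b \<Longrightarrow> s \<le> t \<Longrightarrow> t \<le> u \<Longrightarrow>
    \<exists>y z. psum d s t y \<and> psum d t u z \<and> x \<le> y + z"
proof (induction rule: psum.induct)
  case (base u)
  then show ?case using tri[of s t u] by (intro exI[of _ "d s t"] exI[of _ "d t u"]) (auto intro: psum.base)
next
  case (step v x u)
  have sv: "s \<le> v" using step(1) by (rule psum_le)
  show ?case
  proof (cases "t \<le> v")
    case True
    then obtain y z where yz: "psum d s t y" "psum d t v z" "x \<le> y + z" using step by fastforce
    then show ?thesis using step(2) psum.step[of d t v z u]
      by (intro exI[of _ y] exI[of _ "z + d v u"]) auto
  next
    case False
    then show ?thesis using step sv tri[of v t u] psum.step[of d s v x t]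
      by (intro exI[of _ "x + d v t"] exI[of _ "d t u"]) (auto intro: psum.base)
  qed
qed

lemma V_additive:
  assumes "a \<le> s" "s \<le> t" "t \<le> u" "u \<le> b"
  shows "V s u = V s t + V t u"
proof (rule antisym)
  show "V s u \<le> V s t + V t u"
  proof (rule field_le_epsilon)
    fix e :: real assume "0 < e"
    then obtain x where x: "psum d s u x" "V s u - e < x" using V_approx[of s u e] assms by auto
    obtain y z where "psum d s t y" "psum d t u z" "x \<le> y + z"
      using psum_split[OF x(1), of t] assms by auto
    then show "V s u \<le> V s t + V t u + e" using x psum_le_V[of s t y] psum_le_V[of t u z] assms by auto
  qed
  show "V s t + V t u \<le> V s u"
  proof (rule field_le_epsilon)
    fix e :: real assume "0 < e"
    then obtain x y where "psum d s t x" "V s t - e / 2 < x" "psum d t u y" "V t u - e / 2 < y"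
      using V_approx[of s t "e / 2"] V_approx[of t u "e / 2"] assms by (metis half_gt_zero)
    then show "V s t + V t u \<le> V s u + e"
      using psum_le_V[of s u "x + y"] psum_append[of d t u y s x] assms by auto
  qed
qed

lemma V_nonneg: "\<lbrakk>a \<le> s; s \<le> t; t \<le> b\<rbrakk> \<Longrightarrow> 0 \<le> V s t"
  using d_le_V nonneg by (meson order_trans)

text \<open>\<open>V\<close> is additive and \<open>d\<close> subadditive, so \<open>V - d\<close>
  is superadditive: disjoint intervals inside one cell contribute at most the value of
  \<open>V - d\<close> on that cell. \<open>P\<close> consists of the inner partition points; an
  interval avoiding them lies in a single cell, and the cells add up to
  \<open>V s t - x\<close>.\<close>

lemma V_minus_d_small_partition:
  assumes "psum d s t x" "a \<le> s" "t \<le> b"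
  shows "\<exists>P. finite P \<and> (\<forall>C. finite C \<and> (\<forall>(u, w)\<in>C. s \<le> u \<and> u \<le> w \<and> w \<le> t \<and> {u..w} \<inter> P = {}) \<and>
      pairwise (\<lambda>i j. disjnt {fst i..snd i} {fst j..snd j}) C \<longrightarrow>
      (\<Sum>(u, w)\<in>C. V u w - d u w) \<le> V s t - x)"
  using assms
proof (induction rule: psum.induct)
  case (base t)
  show ?case
  proof (intro exI[of _ "{}"] conjI allI impI)
    fix C assume C: "finite C \<and> (\<forall>(u, w)\<in>C. s \<le> u \<and> u \<le> w \<and> w \<le> t \<and> {u..w} \<inter> {} = {}) \<and>
      pairwise (\<lambda>i j. disjnt {fst i..snd i} {fst j..snd j}) C"
    show "(\<Sum>(u, w)\<in>C. V u w - d u w) \<le> V s t - d s t"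
    proof (rule superadditive_sum_le[where W = "\<lambda>u w. V u w - d u w"])
      fix u x w assume "s \<le> u" "u \<le> x" "x \<le> w" "w \<le> t"
      then show "V u x - d u x + (V x w - d x w) \<le> V u w - d u w"
        using V_additive[of u x w] tri[of u x w] base by auto
    qed (use C d_le_V base in auto)
  qed simp
next
  case (step r x t)
  have sr: "s \<le> r" using step(1) by (rule psum_le)
  then obtain P where P: "finite P" and PC: "\<And>C. finite C \<Longrightarrow>
      (\<And>u w. (u, w)\<in>C \<Longrightarrow> s \<le> u \<and> u \<le> w \<and> w \<le> r \<and> {u..w} \<inter> P = {}) \<Longrightarrow>
      pairwise (\<lambda>i j. disjnt {fst i..snd i} {fst j..snd j}) C \<Longrightarrow>
      (\<Sum>(u, w)\<in>C. V u w - d u w) \<le> V s r - x"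
    using step by fastforce
  show ?case
  proof (intro exI[of _ "insert r P"] conjI allI impI)
    fix C assume C: "finite C \<and> (\<forall>(u, w)\<in>C. s \<le> u \<and> u \<le> w \<and> w \<le> t \<and> {u..w} \<inter> insert r P = {}) \<and>
      pairwise (\<lambda>i j. disjnt {fst i..snd i} {fst j..snd j}) C"
    define C1 where "C1 = {i\<in>C. snd i < r}"
    define C2 where "C2 = {i\<in>C. r < fst i}"
    have "C = C1 \<union> C2" unfolding C1_def C2_def using C by fastforce
    moreover have "C1 \<inter> C2 = {}" unfolding C1_def C2_def using C by fastforce
    moreover have fin: "finite C1" "finite C2" unfolding C1_def C2_def using C by auto
    ultimately have "(\<Sum>(u, w)\<in>C. V u w - d u w) = (\<Sum>(u, w)\<in>C1. V u w - d u w) + (\<Sum>(u, w)\<in>C2. V u w - d u w)"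
      by (simp add: sum.union_disjoint)
    moreover have "(\<Sum>(u, w)\<in>C1. V u w - d u w) \<le> V s r - x"
    proof (rule PC[OF fin(1)])
      show "pairwise (\<lambda>i j. disjnt {fst i..snd i} {fst j..snd j}) C1"
        using C unfolding C1_def by (auto elim!: pairwise_subset)
    qed (use C in \<open>auto simp: C1_def\<close>)
    moreover have "(\<Sum>(u, w)\<in>C2. V u w - d u w) \<le> V r t - d r t"
    proof (rule superadditive_sum_le[where W = "\<lambda>u w. V u w - d u w"])
      fix u x w assume "r \<le> u" "u \<le> x" "x \<le> w" "w \<le> t"
      then show "V u x - d u x + (V x w - d x w) \<le> V u w - d u w"
        using V_additive[of u x w] tri[of u x w] step sr by auto
    next
      show "pairwise (\<lambda>i j. disjnt {fst i..snd i} {fst j..snd j}) C2"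
        using C unfolding C2_def by (auto elim!: pairwise_subset)
    next
      show "r \<le> u \<and> u \<le> w \<and> w \<le> t" if "(u, w) \<in> C2" for u w
        using C that unfolding C2_def by auto
    qed (use fin d_le_V step sr in auto)
    ultimately show "(\<Sum>(u, w)\<in>C. V u w - d u w) \<le> V s t - (x + d r t)"
      using V_additive[of s r t] step sr by auto
  qed (use P in auto)
qed

section \<open>Almost everywhere convergence of the difference quotient\<close>

text \<open>For \<alpha> < \<beta> these are points where the quotient keeps oscillating across the
  gap between \<alpha> and \<beta>. Stating this by frequent occurrence instead of lower and upper
  limits directly supplies the short intervals that a Vitali cover needs.\<close>

definition osc_set :: "real \<Rightarrow> real \<Rightarrow> real set" where
  "osc_set \<alpha> \<beta> = {t\<in>{a<..<b}. (\<exists>\<^sub>F s in at t. d t s < \<alpha> * \<bar>t - s\<bar>) \<and> (\<exists>\<^sub>F s in at t. \<beta> * \<bar>t - s\<bar> < d t s)}"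

lemma frequently_atD:
  fixes t :: real
  assumes "\<exists>\<^sub>F s in at t. P s" "open O'" "t \<in> O'" "0 < e"
  obtains s where "s \<noteq> t" "\<bar>s - t\<bar> < e" "{min s t..max s t} \<subseteq> O'" "P s"
proof -
  obtain r where r: "0 < r" "ball t r \<subseteq> O'" using assms(2,3) openE by blast
  have "\<exists>s. s \<noteq> t \<and> \<bar>s - t\<bar> < min r e \<and> P s"
  proof (rule ccontr)
    assume "\<not> ?thesis"
    then have "\<forall>\<^sub>F s in at t. \<not> P s" unfolding eventually_at using r assms(4)
      by (intro exI[of _ "min r e"]) (auto simp: dist_real_def)
    then show False using assms(1) by (simp add: frequently_def)
  qed
  then obtain s where s: "s \<noteq> t" "\<bar>s - t\<bar> < min r e" "P s" by blast
  have "{min s t..max s t} \<subseteq> ball t r" using s by (auto simp: dist_real_def)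
  then show ?thesis using that s r by auto
qed

text \<open>The interval between \<open>t\<close> and a nearby \<open>s\<close> has length times
  \<beta> below \<open>d\<close>. The Vitali bound asks for superadditivity, which the majorant
  \<open>V\<close> of \<open>d\<close> provides.\<close>

lemma frequently_above_bound:
  assumes S: "\<And>t. t \<in> S \<Longrightarrow> u < t \<and> t < w \<and> (\<exists>\<^sub>F s in at t. \<beta> * \<bar>t - s\<bar> < d t s)"
    and "0 < \<beta>" "a \<le> u" "u \<le> w" "w \<le> b"
  shows "\<exists>B. B \<in> lmeasurable \<and> S \<subseteq> B \<and> measure lebesgue B \<le> V u w / \<beta>"
proof (rule superadditive_Vitali_bound[of u w V \<beta> S])
  fix t e :: real assume t: "t \<in> S" and "0 < e"
  obtain s where s: "s \<noteq> t" "\<bar>s - t\<bar> < e" "{min s t..max s t} \<subseteq> {u<..<w}" "\<beta> * \<bar>t - s\<bar> < d t s"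
    using S[OF t] \<open>0 < e\<close> frequently_atD[where t = t and O' = "{u<..<w}" and e = e and P = "\<lambda>s. \<beta> * \<bar>t - s\<bar> < d t s"]
    by auto
  have mm: "min s t \<in> {u<..<w}" "max s t \<in> {u<..<w}" using s(3) by (auto simp: subset_iff)
  have len: "min s t < max s t" "max s t - min s t < e" using s(1,2) by linarith+
  have "\<beta> * (max s t - min s t) < d (min s t) (max s t)"
    using s(4) sym[of s t] by (cases "s \<le> t") (simp_all add: min_def max_def)
  also have "\<dots> \<le> V (min s t) (max s t)"
    using mm assms by (intro d_le_V) auto
  finally show "\<exists>u' w'. u \<le> u' \<and> u' \<le> t \<and> t \<le> w' \<and> w' \<le> w \<and> u' < w' \<and> w' - u' < e \<and> \<beta> * (w' - u') < V u' w'"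
    using mm len by (intro exI[of _ "min s t"] exI[of _ "max s t"]) simp
next
  show "V r x + V x y \<le> V r y" if "u \<le> r" "r \<le> x" "x \<le> y" "y \<le> w" for r x y
    using V_additive[of r x y] that assms by simp
next
  show "0 \<le> V r y" if "u \<le> r" "r \<le> y" "y \<le> w" for r y
    using V_nonneg that assms by simp
qed (use assms in blast)+

lemma negligible_unbounded_quotient:
  "negligible {t\<in>{a<..<b}. \<forall>\<beta>::nat. \<exists>\<^sub>F s in at t. \<beta> * \<bar>t - s\<bar> < d t s}" (is "negligible ?S")
proof -
  have "\<exists>T. ?S \<subseteq> T \<and> T \<in> lmeasurable \<and> measure lebesgue T < e" if "0 < e" for e :: real
  proof -
    \<comment> \<open>The cover obtained for \<beta> = \<open>n\<close> has measure at most
      \<open>V a b / n\<close>, which is below \<open>e\<close> for this \<open>n\<close>.\<close>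
    obtain n :: nat where n: "V a b / e < n" using reals_Archimedean2 by blast
    have "0 \<le> V a b / e" using V_nonneg[of a b] ab \<open>0 < e\<close> by simp
    then have "0 < real n" using n by linarith
    then obtain B where "B \<in> lmeasurable" "?S \<subseteq> B" "measure lebesgue B \<le> V a b / n"
      using frequently_above_bound[of ?S a b n] ab by auto
    moreover have "V a b / n < e" using n \<open>0 < real n\<close> \<open>0 < e\<close> by (simp add: field_simps)
    ultimately show ?thesis by (intro exI[of _ B]) auto
  qed
  then show ?thesis unfolding negligible_outer by blast
qed

text \<open>Almost all of \<open>osc_set \<alpha> \<beta>\<close> is covered by disjoint intervals on which \<open>d\<close> is at most \<open>\<alpha>\<close> times the
  length; avoiding the points of a nearly optimal partition makes the total variation over
  these intervals hardly larger than \<open>d\<close>, whereas a second covering bounds it from below by \<open>\<beta>\<close> times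
  the measure of the set.\<close>

lemma osc_set_step:
  assumes "\<alpha> < \<beta>" "0 < \<alpha>" "0 < e"
    and B: "B \<in> lmeasurable" "osc_set \<alpha> \<beta> \<subseteq> B"
  shows "\<exists>B'. B' \<in> lmeasurable \<and> osc_set \<alpha> \<beta> \<subseteq> B' \<and> \<beta> * measure lebesgue B' \<le> \<alpha> * (measure lebesgue B + e) + e"
proof -
  obtain x where x: "psum d a b x" "V a b - e < x" using V_approx ab \<open>0 < e\<close> by blast
  obtain P where P: "finite P" and PC: "\<And>C. finite C \<Longrightarrow>
      (\<And>u w. (u, w)\<in>C \<Longrightarrow> a \<le> u \<and> u \<le> w \<and> w \<le> b \<and> {u..w} \<inter> P = {}) \<Longrightarrow>
      pairwise (\<lambda>i j. disjnt {fst i..snd i} {fst j..snd j}) C \<Longrightarrow>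
      (\<Sum>(u, w)\<in>C. V u w - d u w) \<le> V a b - x"
    using V_minus_d_small_partition[OF x(1)] ab by fastforce
  obtain O1 where O1: "open O1" "B \<subseteq> O1" "O1 - B \<in> lmeasurable" "emeasure lebesgue (O1 - B) < ennreal e"
    using sets_lebesgue_outer_open[of B e] B(1) \<open>0 < e\<close> by blast
  have "O1 = B \<union> (O1 - B)" using O1 by auto
  then have O1m: "O1 \<in> lmeasurable" using B O1 by (metis fmeasurable.Un)
  have "measure lebesgue O1 = measure lebesgue B + measure lebesgue (O1 - B)"
    using O1 O1m B by (simp add: measurable_measure_Diff fmeasurableD)
  moreover have "measure lebesgue (O1 - B) < e"
    using O1 \<open>0 < e\<close> by (simp add: emeasure_eq_measure2 ennreal_less_iff)
  ultimately have O1e: "measure lebesgue O1 < measure lebesgue B + e" by simp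
  \<comment> \<open>Intervals inside \<open>Oo\<close> avoid the points \<open>P\<close>, as the
    bound on \<open>V - d\<close> demands, and stay in \<open>O1\<close>, so that disjoint ones have
    total length at most \<open>measure lebesgue B + e\<close>.\<close>
  define Oo where "Oo = O1 \<inter> {a<..<b} - P"
  have Oo: "open Oo" unfolding Oo_def using O1(1) P by (intro open_Diff open_Int finite_imp_closed) auto
  define K where "K = {(u, w). u < w \<and> {u..w} \<subseteq> Oo \<and> d u w < \<alpha> * (w - u)}"
  obtain C where C: "countable C" "C \<subseteq> K"
    "pairwise (\<lambda>i j. disjnt {fst i..snd i} {fst j..snd j}) C"
    "negligible (osc_set \<alpha> \<beta> - P - (\<Union>i\<in>C. {fst i..snd i}))"
  proof (rule Vitali_cover_intervals[of "osc_set \<alpha> \<beta> - P" K])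
    fix t e assume t: "t \<in> osc_set \<alpha> \<beta> - P" and "(0::real) < e"
    have "t \<in> Oo" using t B O1 unfolding Oo_def osc_set_def by auto
    then obtain s where s: "s \<noteq> t" "\<bar>s - t\<bar> < e" "{min s t..max s t} \<subseteq> Oo" "d t s < \<alpha> * \<bar>t - s\<bar>"
      using t Oo \<open>0 < e\<close> frequently_atD[where t = t and O' = Oo and e = e and P = "\<lambda>s. d t s < \<alpha> * \<bar>t - s\<bar>"]
      unfolding osc_set_def by blast
    have len: "min s t < max s t" "max s t - min s t < e" using s(1,2) by linarith+
    have "d (min s t) (max s t) < \<alpha> * (max s t - min s t)"
      using s(4) sym[of s t] by (cases "s \<le> t") (simp_all add: min_def max_def)
    then show "\<exists>u w. (u, w) \<in> K \<and> u \<le> t \<and> t \<le> w \<and> w - u < e"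
      using s(3) len unfolding K_def
      by (intro exI[of _ "min s t"] exI[of _ "max s t"]) simp
  qed (auto simp: K_def)
  have Cin: "a < u \<and> u < w \<and> w < b \<and> {u..w} \<inter> P = {} \<and> {u..w} \<subseteq> O1 \<and> d u w < \<alpha> * (w - u)" if "(u, w) \<in> C" for u w
  proof -
    have "(u, w) \<in> K" using that C(2) by auto
    then have uw: "u < w" "{u..w} \<subseteq> Oo" "d u w < \<alpha> * (w - u)" unfolding K_def by auto
    then have "u \<in> Oo" "w \<in> Oo" by auto
    then show ?thesis using uw unfolding Oo_def by auto
  qed
  \<comment> \<open>The second covering is done separately inside each interval of \<open>C\<close>;
    taking the interval open leaves room on both sides of each of its points.\<close>
  have "\<exists>B. B \<in> lmeasurable \<and> osc_set \<alpha> \<beta> \<inter> {fst i<..<snd i} \<subseteq> B \<and> measure lebesgue B \<le> V (fst i) (snd i) / \<beta>"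
    if "i \<in> C" for i
  proof -
    have "a < fst i \<and> fst i < snd i \<and> snd i < b" using Cin[of "fst i" "snd i"] that by auto
    then show ?thesis
      using assms by (intro frequently_above_bound) (auto simp: osc_set_def)
  qed
  then obtain D where D: "\<And>i. i \<in> C \<Longrightarrow> D i \<in> lmeasurable \<and> osc_set \<alpha> \<beta> \<inter> {fst i<..<snd i} \<subseteq> D i \<and>
      measure lebesgue (D i) \<le> V (fst i) (snd i) / \<beta>" by metis
  define R where "R = (\<alpha> * (measure lebesgue B + e) + e) / \<beta>"
  have bound: "measure lebesgue (\<Union>i\<in>C'. D i) \<le> R" if C': "C' \<subseteq> C" "finite C'" for C'
  proof -
    have pw: "pairwise (\<lambda>i j. disjnt {fst i..snd i} {fst j..snd j}) C'"
      using C(3) C'(1) by (rule pairwise_subset)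
    have "measure lebesgue (\<Union>i\<in>C'. D i) \<le> (\<Sum>i\<in>C'. measure lebesgue (D i))"
      using C' D by (intro measure_UNION_le) (auto simp: fmeasurableD)
    also have "\<dots> \<le> (\<Sum>i\<in>C'. V (fst i) (snd i) / \<beta>)" using D C' by (intro sum_mono) auto
    also have "\<dots> = (\<Sum>i\<in>C'. V (fst i) (snd i)) / \<beta>" by (simp add: sum_divide_distrib)
    also have "(\<Sum>i\<in>C'. V (fst i) (snd i)) \<le> \<alpha> * (measure lebesgue B + e) + e"
    proof -
      \<comment> \<open>Split \<open>V\<close> into \<open>V - d\<close> and \<open>d\<close>: the
        first sum is below \<open>e\<close> because the partition is nearly optimal, the second is
        at most \<alpha> times the total length by the choice of \<open>K\<close>.\<close>
      have 1: "(\<Sum>(u, w)\<in>C'. V u w - d u w) \<le> V a b - x"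
        using PC[OF C'(2) _ pw] Cin C'(1) by (metis less_le subsetD)
      have 2: "(\<Sum>i\<in>C'. d (fst i) (snd i)) \<le> (\<Sum>i\<in>C'. \<alpha> * measure lebesgue {fst i..snd i})"
      proof (rule sum_mono)
        fix i assume "i \<in> C'"
        then show "d (fst i) (snd i) \<le> \<alpha> * measure lebesgue {fst i..snd i}"
          using Cin[of "fst i" "snd i"] C'(1) by auto
      qed
      have dj: "disjoint_family_on (\<lambda>i. {fst i..snd i}) C'"
        using pw unfolding disjoint_family_on_def pairwise_def disjnt_def by blast
      have "(\<Sum>i\<in>C'. measure lebesgue {fst i..snd i}) = measure lebesgue (\<Union>i\<in>C'. {fst i..snd i})"
      proof (intro measure_finite_Union[symmetric])
        show "emeasure lebesgue {fst i..snd i} \<noteq> \<infinity>" for i :: "real \<times> real"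
          using fmeasurableD2[OF lmeasurable_interval(1)] by (simp only: infinity_ennreal_def not_False_eq_True)
        show "(\<lambda>i. {fst i..snd i}) ` C' \<subseteq> sets lebesgue"
          by (simp add: image_subset_iff)
      qed (fact C'(2) dj)+
      also have "\<dots> \<le> measure lebesgue O1"
      proof (rule measure_mono_fmeasurable[OF _ _ O1m])
        have "{fst i..snd i} \<subseteq> O1" if "i \<in> C'" for i
          using Cin[of "fst i" "snd i"] C'(1) that by auto
        then show "(\<Union>i\<in>C'. {fst i..snd i}) \<subseteq> O1" by blast
        show "(\<Union>i\<in>C'. {fst i..snd i}) \<in> sets lebesgue" using C'(2) by auto
      qed
      finally have "(\<Sum>i\<in>C'. measure lebesgue {fst i..snd i}) \<le> measure lebesgue B + e" using O1e by linarith
      then have "(\<Sum>i\<in>C'. \<alpha> * measure lebesgue {fst i..snd i}) \<le> \<alpha> * (measure lebesgue B + e)"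
        using assms(2) by (simp add: sum_distrib_left[symmetric])
      then show ?thesis using 1 2 x(2) by (simp add: case_prod_unfold sum_subtractf)
    qed
    finally show ?thesis unfolding R_def using assms by (simp add: divide_right_mono)
  qed
  have DU: "(\<Union>i\<in>C. D i) \<in> lmeasurable" "measure lebesgue (\<Union>i\<in>C. D i) \<le> R"
    using C(1) D bound by (auto intro!: fmeasurable_UN_bound[of C _ _ R] measure_UN_bound[of C _ _ R])
  \<comment> \<open>The points that the sets \<open>D i\<close> may miss: the remainder of the first
    covering, the partition points, and the end points lost by passing to open intervals.\<close>
  define N where "N = (osc_set \<alpha> \<beta> - P - (\<Union>i\<in>C. {fst i..snd i})) \<union> P \<union> (\<Union>i\<in>C. {fst i, snd i})"
  have "negligible (\<Union>i\<in>C. {fst i, snd i})"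
    using C(1) unfolding negligible_iff_null_sets
    by (intro null_sets_completionI countable_imp_null_set_lborel countable_UN) auto
  then have N: "N \<in> null_sets lebesgue" unfolding N_def negligible_iff_null_sets[symmetric]
    using C(4) P by (auto intro!: negligible_Un intro: negligible_finite)
  have "osc_set \<alpha> \<beta> \<subseteq> (\<Union>i\<in>C. D i) \<union> N"
  proof
    fix t assume t: "t \<in> osc_set \<alpha> \<beta>"
    show "t \<in> (\<Union>i\<in>C. D i) \<union> N"
    proof (cases "t \<in> N")
      case False
      then obtain i where "i \<in> C" "t \<in> {fst i<..<snd i}" using t unfolding N_def by force
      then show ?thesis using D[of i] t by auto
    qed simp
  qed
  moreover have "measure lebesgue ((\<Union>i\<in>C. D i) \<union> N) = measure lebesgue (\<Union>i\<in>C. D i)"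
    using N DU by (intro measure_Un_null_set) (auto simp: fmeasurableD)
  moreover have "(\<Union>i\<in>C. D i) \<union> N \<in> lmeasurable"
    by (rule fmeasurable.Un[OF DU(1) fmeasurableI_null_sets[OF N]])
  moreover have "\<beta> * R = \<alpha> * (measure lebesgue B + e) + e" unfolding R_def using assms by simp
  moreover have "\<beta> * measure lebesgue (\<Union>i\<in>C. D i) \<le> \<beta> * R" using DU assms by simp
  ultimately show ?thesis by (intro exI[of _ "(\<Union>i\<in>C. D i) \<union> N"]) auto
qed

text \<open>The outer measure \<open>m\<close> is finite because the set is bounded. Feeding nearly
  optimal covers into \<open>osc_set_step\<close> gives \<beta> \<open>m\<close> \<le> \<alpha>
  \<open>m\<close>, which forces \<open>m = 0\<close>.\<close>

lemma negligible_osc_set: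
  assumes "\<alpha> < \<beta>" "0 < \<alpha>"
  shows "negligible (osc_set \<alpha> \<beta>)"
proof -
  define M where "M = {measure lebesgue B |B. B \<in> lmeasurable \<and> osc_set \<alpha> \<beta> \<subseteq> B}"
  define m where "m = Inf M"
  have bdd: "bdd_below M" unfolding M_def by (rule bdd_belowI[of _ 0]) auto
  have "osc_set \<alpha> \<beta> \<subseteq> {a..b}" unfolding osc_set_def by auto
  then have ne: "M \<noteq> {}" unfolding M_def by blast
  have "0 \<le> m" unfolding m_def using ne by (intro cInf_greatest) (auto simp: M_def)
  have less: "\<exists>B. B \<in> lmeasurable \<and> osc_set \<alpha> \<beta> \<subseteq> B \<and> measure lebesgue B < r" if "m < r" for r
    using cInf_lessD[OF ne that[unfolded m_def]] unfolding M_def by blast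
  have "\<beta> * m \<le> \<alpha> * m + e" if "0 < e" for e
  proof -
    \<comment> \<open>One \<open>e'\<close> is lost in choosing \<open>B\<close> and one inside the
      parenthesis of \<open>osc_set_step\<close>, both multiplied by \<alpha>, and a third is added
      outside; this choice makes the total loss exactly \<open>e\<close>.\<close>
    define e' where "e' = e / (2 * \<alpha> + 1)"
    have "e' * (2 * \<alpha> + 1) = e" unfolding e'_def using assms by simp
    then have "\<alpha> * (2 * e') + e' = e" by (simp add: algebra_simps)
    moreover have "0 < e'" unfolding e'_def using \<open>0 < e\<close> assms by simp
    ultimately have e': "0 < e'" "\<alpha> * (2 * e') + e' = e" by auto
    obtain B where B: "B \<in> lmeasurable" "osc_set \<alpha> \<beta> \<subseteq> B" "measure lebesgue B < m + e'"
      using less[of "m + e'"] e'(1) by fastforce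
    obtain B' where B': "B' \<in> lmeasurable" "osc_set \<alpha> \<beta> \<subseteq> B'"
      "\<beta> * measure lebesgue B' \<le> \<alpha> * (measure lebesgue B + e') + e'"
      using osc_set_step[OF assms e'(1) B(1,2)] by blast
    have "m \<le> measure lebesgue B'" unfolding m_def
      by (rule cInf_lower[OF _ bdd]) (use B'(1,2) in \<open>unfold M_def, blast\<close>)
    then have "\<beta> * m \<le> \<beta> * measure lebesgue B'" using assms by simp
    also have "\<dots> \<le> \<alpha> * (measure lebesgue B + e') + e'" by (rule B')
    also have "\<dots> \<le> \<alpha> * (m + 2 * e') + e'" using B(3) assms(2) by simp
    also have "\<dots> = \<alpha> * m + e" using e' by (simp add: algebra_simps)
    finally show ?thesis .
  qed
  then have "\<beta> * m \<le> \<alpha> * m" by (rule field_le_epsilon)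
  then have "m = 0" using \<open>0 \<le> m\<close> assms(1) mult_strict_right_mono[of \<alpha> \<beta> m] by linarith
  then show ?thesis unfolding negligible_outer
  proof (intro allI impI)
    fix e :: real assume "0 < e"
    then show "\<exists>T. osc_set \<alpha> \<beta> \<subseteq> T \<and> T \<in> lmeasurable \<and> measure lebesgue T < e"
      using less[of e] \<open>m = 0\<close> by blast
  qed
qed

text \<open>Outside the first part of \<open>N\<close> the upper limit of the quotient is finite. A
  gap between lower and upper limit would contain rationals \<alpha> < \<beta> and put the point
  into \<open>osc_set \<alpha> \<beta>\<close>; there are only countably many such pairs.\<close>

lemma AE_metric_derivative_exists:
  "AE t in lebesgue. t \<in> {a<..<b} \<longrightarrow> (\<exists>L. ((\<lambda>s. d t s / \<bar>t - s\<bar>) \<longlongrightarrow> L) (at t))"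
proof -
  define N where "N = {t\<in>{a<..<b}. \<forall>\<beta>::nat. \<exists>\<^sub>F s in at t. \<beta> * \<bar>t - s\<bar> < d t s} \<union>
     (\<Union>(\<alpha>, \<beta>)\<in>{(\<alpha>, \<beta>). \<alpha> \<in> \<rat> \<and> \<beta> \<in> \<rat> \<and> 0 < \<alpha> \<and> \<alpha> < \<beta>}. osc_set \<alpha> \<beta>)"
  have "countable {(\<alpha>::real, \<beta>::real). \<alpha> \<in> \<rat> \<and> \<beta> \<in> \<rat> \<and> 0 < \<alpha> \<and> \<alpha> < \<beta>}"
    by (rule countable_subset[of _ "\<rat> \<times> \<rat>"]) (auto simp: countable_rat)
  then have "negligible N" unfolding N_def
    by (intro negligible_Un negligible_unbounded_quotient negligible_countable_Union countable_image)
       (auto intro: negligible_osc_set)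
  then have N: "N \<in> null_sets lebesgue" by (simp add: negligible_iff_null_sets)
  have "\<exists>L. ((\<lambda>s. d t s / \<bar>t - s\<bar>) \<longlongrightarrow> L) (at t)" if t: "t \<in> {a<..<b}" "t \<notin> N" for t
  proof -
    define q where "q = (\<lambda>s. d t s / \<bar>t - s\<bar>)"
    have q0: "0 \<le> q s" for s unfolding q_def using nonneg by simp
    have ne: "\<forall>\<^sub>F s in at t. s \<noteq> t" by (simp add: eventually_at_filter)
    have less: "\<forall>\<^sub>F s in at t. (d t s < \<alpha> * \<bar>t - s\<bar>) = (q s < \<alpha>) \<and> (\<alpha> * \<bar>t - s\<bar> < d t s) = (\<alpha> < q s)" for \<alpha>
      using ne by eventually_elim (auto simp: q_def field_simps)
    obtain n :: nat where n: "\<not> (\<exists>\<^sub>F s in at t. n * \<bar>t - s\<bar> < d t s)" using t unfolding N_def by auto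
    have n: "\<forall>\<^sub>F s in at t. ereal (q s) \<le> ereal n"
      using n[unfolded not_frequently] less[of n] by eventually_elim auto
    have le: "Limsup (at t) (\<lambda>s. ereal (q s)) \<le> Liminf (at t) (\<lambda>s. ereal (q s))"
    proof (rule ccontr)
      assume "\<not> ?thesis"
      then have "Liminf (at t) (\<lambda>s. ereal (q s)) < Limsup (at t) (\<lambda>s. ereal (q s))" by simp
      then obtain z1 where z1: "Liminf (at t) (\<lambda>s. ereal (q s)) < ereal z1" "ereal z1 < Limsup (at t) (\<lambda>s. ereal (q s))"
        using ereal_dense2 by blast
      obtain z2 where z2: "ereal z1 < ereal z2" "ereal z2 < Limsup (at t) (\<lambda>s. ereal (q s))"
        using ereal_dense2[OF z1(2)] by blast
      obtain \<alpha> where \<alpha>: "\<alpha> \<in> \<rat>" "z1 < \<alpha>" "\<alpha> < z2" using Rats_dense_in_real[of z1 z2] z2 by auto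
      obtain \<beta> where \<beta>: "\<beta> \<in> \<rat>" "\<alpha> < \<beta>" "\<beta> < z2" using Rats_dense_in_real[of \<alpha> z2] \<alpha> by auto
      have fa: "\<exists>\<^sub>F s in at t. q s < \<alpha>"
      proof (rule ccontr)
        assume "\<not> ?thesis"
        then have "\<forall>\<^sub>F s in at t. ereal z1 \<le> ereal (q s)" unfolding not_frequently
          by eventually_elim (use \<alpha> in auto)
        then show False using Liminf_bounded z1(1) by (metis not_le)
      qed
      have fb: "\<exists>\<^sub>F s in at t. \<beta> < q s"
      proof (rule ccontr)
        assume "\<not> ?thesis"
        then have "\<forall>\<^sub>F s in at t. ereal (q s) \<le> ereal z2" unfolding not_frequently
          by eventually_elim (use \<beta> in auto)
        then show False using Limsup_bounded z2(2) by (metis not_le)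
      qed
      have "0 < \<alpha>" using frequently_ex[OF fa] q0 by (metis le_less_trans)
      have "\<exists>\<^sub>F s in at t. d t s < \<alpha> * \<bar>t - s\<bar>"
        using fa by (rule frequently_rev_mp) (use less[of \<alpha>] in \<open>auto elim: eventually_mono\<close>)
      moreover have "\<exists>\<^sub>F s in at t. \<beta> * \<bar>t - s\<bar> < d t s"
        using fb by (rule frequently_rev_mp) (use less[of \<beta>] in \<open>auto elim: eventually_mono\<close>)
      ultimately have "t \<in> osc_set \<alpha> \<beta>" using t unfolding osc_set_def by auto
      then show False using t(2) \<alpha>(1) \<beta>(1,2) \<open>0 < \<alpha>\<close> unfolding N_def by auto
    qed
    have lo: "0 \<le> Liminf (at t) (\<lambda>s. ereal (q s))" using q0 by (intro Liminf_bounded) auto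
    have hi: "Limsup (at t) (\<lambda>s. ereal (q s)) \<le> ereal n" using n by (rule Limsup_bounded)
    have LL: "Liminf (at t) (\<lambda>s. ereal (q s)) = Limsup (at t) (\<lambda>s. ereal (q s))"
      using le Liminf_le_Limsup[of "at t" "\<lambda>s. ereal (q s)"] by simp
    then obtain L where L: "Limsup (at t) (\<lambda>s. ereal (q s)) = ereal L"
      using lo hi by (cases "Limsup (at t) (\<lambda>s. ereal (q s))") auto
    have "((\<lambda>s. ereal (q s)) \<longlongrightarrow> ereal L) (at t)"
      using L LL by (intro Liminf_eq_Limsup) auto
    then show ?thesis unfolding q_def by auto
  qed
  then show ?thesis by (intro AE_I'[OF N]) auto
qed

end

text \<open>Bisection, where intervals around points of the exceptional null set are paid for by \<open>\<integral>m\<close> over a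
  small open neighbourhood of that set.\<close>

lemma subadditive_AE_bound:
  fixes D :: "real \<Rightarrow> real \<Rightarrow> real" and m :: "real \<Rightarrow> real"
  assumes "a \<le> b" "0 \<le> e"
    and sub: "\<And>u x w. \<lbrakk>a \<le> u; u \<le> x; x \<le> w; w \<le> b\<rbrakk> \<Longrightarrow> D u w \<le> D u x + D x w"
    and m: "set_integrable lborel {a..b} m"
    and Dm: "\<And>u w. \<lbrakk>a \<le> u; u \<le> w; w \<le> b\<rbrakk> \<Longrightarrow> D u w \<le> (LINT r:{u..w}|lborel. m r)"
    and loc: "AE x in lborel. x \<in> {a..b} \<longrightarrow>
      (\<exists>\<delta>>0. \<forall>u\<in>{a..b}. \<bar>u - x\<bar> < \<delta> \<longrightarrow> D (min u x) (max u x) \<le> e * \<bar>u - x\<bar>)"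
  shows "D a b \<le> e * (b - a)"
proof (rule field_le_epsilon)
  fix r :: real assume "0 < r"
  \<comment> \<open>\<open>M\<close> has density |\<open>m\<close>| on \<open>{a..b}\<close>. It is
    finite, hence outer regular, and absolutely continuous, so the exceptional null set
    \<open>N\<close> has an open neighbourhood \<open>U\<close> with \<open>M\<close>-mass below
    \<open>r\<close>.\<close>
  define g where "g x = ennreal \<bar>indicator {a..b} x *\<^sub>R m x\<bar>" for x
  have im: "integrable lborel (\<lambda>x. indicator {a..b} x *\<^sub>R m x)"
    using m unfolding set_integrable_def .
  then have [measurable]: "g \<in> borel_measurable lborel" unfolding g_def by measurable
  define M where "M = density lborel g"
  have setsM [measurable_cong]: "sets M = sets borel" unfolding M_def by simp
  have spaceM: "space M = UNIV" unfolding M_def by simp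
  have "emeasure M (space M) = (\<integral>\<^sup>+x. g x \<partial>lborel)"
    unfolding M_def by (simp add: emeasure_density)
  also have "\<dots> < \<infinity>" using im unfolding g_def integrable_iff_bounded by simp
  finally have fin: "emeasure M (space M) \<noteq> \<infinity>" by simp
  interpret M: finite_measure M by (rule finite_measureI[OF fin])
  have ac: "absolutely_continuous lborel M" unfolding M_def by (rule absolutely_continuousI_density) simp
  define Q where "Q x \<longleftrightarrow> (\<exists>\<delta>>0. \<forall>u\<in>{a..b}. \<bar>u - x\<bar> < \<delta> \<longrightarrow> D (min u x) (max u x) \<le> e * \<bar>u - x\<bar>)" for x
  obtain N where good: "\<And>x. x \<in> space lborel - N \<Longrightarrow> x \<in> {a..b} \<longrightarrow> Q x" and N: "N \<in> null_sets lborel"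
    using loc unfolding Q_def[symmetric] by (rule AE_E3) (rule that)
  have MN: "emeasure M N = 0" "emeasure M {x} = 0" for x
    using ac N finite_imp_null_set_lborel[of "{x}"] unfolding absolutely_continuous_def by auto
  have "(INF U \<in> {U. N \<subseteq> U \<and> open U}. emeasure M U) = 0"
    using outer_regular[OF setsM fin, of N] N MN by auto
  then obtain U where U: "N \<subseteq> U" "open U" "emeasure M U < ennreal r"
    using \<open>0 < r\<close> by (metis (mono_tags, lifting) INF_less_iff ennreal_less_zero_iff mem_Collect_eq)
  have Ur: "measure M U < r" using U(3) \<open>0 < r\<close> by (simp add: M.emeasure_eq_measure ennreal_less_iff)
  have [measurable]: "U \<in> sets borel" using U by simp
  \<comment> \<open>Half-open intervals make the masses of adjacent pieces add up exactly; the
    omitted end point has \<open>M\<close>-mass zero.\<close>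
  have Mge: "(LINT r:{u..w}|lborel. m r) \<le> measure M {u<..w}" if uw: "a \<le> u" "u \<le> w" "w \<le> b" for u w
  proof -
    have iuw: "integrable lborel (\<lambda>x. indicator {u..w} x *\<^sub>R m x)"
      using set_integrable_subset[OF m, of "{u..w}"] uw unfolding set_integrable_def by auto
    have "(LINT r:{u..w}|lborel. m r) \<le> (LINT x|lborel. \<bar>indicator {u..w} x *\<^sub>R m x\<bar>)"
      unfolding set_lebesgue_integral_def by (intro integral_mono integrable_abs iuw) simp
    then have "ennreal (LINT r:{u..w}|lborel. m r) \<le> ennreal (LINT x|lborel. \<bar>indicator {u..w} x *\<^sub>R m x\<bar>)"
      by (rule ennreal_leI)
    also have "\<dots> = (\<integral>\<^sup>+x. ennreal \<bar>indicator {u..w} x *\<^sub>R m x\<bar> \<partial>lborel)"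
      by (intro nn_integral_eq_integral[symmetric] integrable_abs iuw) simp
    also have "\<dots> = emeasure M {u..w}"
      unfolding M_def by (subst emeasure_density)
        (use uw in \<open>auto simp: g_def indicator_def intro!: nn_integral_cong\<close>)
    also have "\<dots> = emeasure M ({u<..w} \<union> {u})" using uw by (intro arg_cong2[where f = emeasure]) auto
    also have "\<dots> = emeasure M {u<..w}"
      by (rule emeasure_Un_null_set) (auto simp: null_sets_def MN)
    finally show ?thesis by (simp add: M.emeasure_eq_measure)
  qed
  \<comment> \<open>The error term is the mass of \<open>U\<close> inside the interval rather than
    all of \<open>r\<close>: it is additive, so it does not accumulate when intervals are joined,
    and it is at most \<open>r\<close> in the end.\<close>
  have "a \<le> a \<and> a \<le> b \<and> b \<le> b \<longrightarrow> D a b \<le> e * (b - a) + measure M (U \<inter> {a<..b})"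
    using \<open>a \<le> b\<close>
  proof (induction rule: Bolzano[where P = "\<lambda>u w. a \<le> u \<and> u \<le> w \<and> w \<le> b \<longrightarrow>
      D u w \<le> e * (w - u) + measure M (U \<inter> {u<..w})"])
    case (trans u x w)
    show ?case
    proof
      assume uw: "a \<le> u \<and> u \<le> w \<and> w \<le> b"
      have "U \<inter> {u<..w} = U \<inter> {u<..x} \<union> U \<inter> {x<..w}" using trans(3,4) by auto
      then have "measure M (U \<inter> {u<..w}) = measure M (U \<inter> {u<..x}) + measure M (U \<inter> {x<..w})"
        by (simp only:) (intro M.finite_measure_Union, auto)
      moreover have "D u w \<le> D u x + D x w" using sub trans uw by auto
      ultimately show "D u w \<le> e * (w - u) + measure M (U \<inter> {u<..w})"
        using trans uw by (auto simp: algebra_simps)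
    qed
  next
    case (local x)
    show ?case
    proof (cases "x \<in> N")
      case True
      then obtain \<delta> where \<delta>: "0 < \<delta>" "ball x \<delta> \<subseteq> U" using U openE by blast
      show ?thesis
      proof (intro exI[of _ \<delta>] conjI allI impI)
        fix u w assume *: "u \<le> x \<and> x \<le> w \<and> w - u < \<delta>" "a \<le> u \<and> u \<le> w \<and> w \<le> b"
        have "{u<..w} \<subseteq> ball x \<delta>" using * by (auto simp: dist_real_def)
        then have "U \<inter> {u<..w} = {u<..w}" using \<delta> by auto
        moreover have "0 \<le> e * (w - u)" using * assms(2) by simp
        ultimately show "D u w \<le> e * (w - u) + measure M (U \<inter> {u<..w})"
          using Dm[of u w] Mge[of u w] * by auto
      qed (rule \<delta>)
    next
      case False
      then obtain \<delta> where \<delta>: "0 < \<delta>" "\<And>u. u \<in> {a..b} \<Longrightarrow> \<bar>u - x\<bar> < \<delta> \<Longrightarrow> D (min u x) (max u x) \<le> e * \<bar>u - x\<bar>"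
        using good[of x] local unfolding Q_def by auto
      show ?thesis
      proof (intro exI[of _ \<delta>] conjI allI impI)
        fix u w assume *: "u \<le> x \<and> x \<le> w \<and> w - u < \<delta>" "a \<le> u \<and> u \<le> w \<and> w \<le> b"
        have "D u x \<le> e * (x - u)" "D x w \<le> e * (w - x)"
          using \<delta>(2)[of u] \<delta>(2)[of w] * by (auto simp: min_absorb1 max_absorb2 min_absorb2 max_absorb1)
        moreover have "D u w \<le> D u x + D x w" using sub * by auto
        moreover have "0 \<le> measure M (U \<inter> {u<..w})" by simp
        ultimately show "D u w \<le> e * (w - u) + measure M (U \<inter> {u<..w})"
          unfolding right_diff_distrib by linarith
      qed (rule \<delta>)
    qed
  qed
  moreover have "measure M (U \<inter> {a<..b}) \<le> measure M U" by (intro M.finite_measure_mono) (auto simp: setsM)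
  ultimately show "D a b \<le> e * (b - a) + r" using Ur \<open>a \<le> b\<close> by auto
qed

section \<open>The Levy--Prokhorov and Wasserstein distances\<close>

lemma Pp_imp_Prob: "\<mu> \<in> Pp p \<Longrightarrow> \<mu> \<in> Prob"
  by (simp add: Pp_def)

lemma ProbD:
  assumes "\<mu> \<in> Prob"
  shows "sets \<mu> = sets borel" "prob_space \<mu>" "space \<mu> = UNIV"
  using assms sets_eq_imp_space_eq[of \<mu> borel] by (auto simp: Prob_def)

lemma open_enlarge: "open (enlarge A e)"
proof -
  have "enlarge A e = (\<Union>y\<in>A. ball y e)" by (auto simp: enlarge_def dist_commute)
  then show ?thesis by (simp add: open_UN)
qed

lemma enlarge_borel: "enlarge A e \<in> sets borel"
  by (rule borel_open[OF open_enlarge])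

lemma enlarge_enlarge: "enlarge (enlarge A e) f \<subseteq> enlarge A (e + f)"
proof
  fix x assume "x \<in> enlarge (enlarge A e) f"
  then obtain y z where "z \<in> A" "dist y z < e" "dist x y < f" unfolding enlarge_def by blast
  then have "dist x z < e + f" using dist_triangle[of x z y] by linarith
  then show "x \<in> enlarge A (e + f)" using \<open>z \<in> A\<close> unfolding enlarge_def by blast
qed

definition LP_close :: "'a::polish_space measure \<Rightarrow> 'a measure \<Rightarrow> real \<Rightarrow> bool" where
  "LP_close \<mu> \<nu> e \<longleftrightarrow> e > 0 \<and> (\<forall>A \<in> sets borel.
      measure \<mu> A \<le> measure \<nu> (enlarge A e) + e \<and> measure \<nu> A \<le> measure \<mu> (enlarge A e) + e)"

lemma dLP_alt: "dLP \<mu> \<nu> = Inf {e. LP_close \<mu> \<nu> e}"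
  by (simp add: dLP_def LP_close_def)

lemma bdd_below_LP_close: "bdd_below {e. LP_close \<mu> \<nu> e}"
  by (rule bdd_belowI[of _ 0]) (auto simp: LP_close_def)

lemma dLP_le: "LP_close \<mu> \<nu> e \<Longrightarrow> dLP \<mu> \<nu> \<le> e"
  unfolding dLP_alt by (rule cInf_lower[OF _ bdd_below_LP_close]) simp

text \<open>This makes the set of admissible radii nonempty; the real \<open>Inf\<close> of the
  empty set would carry no information about the distance.\<close>

lemma LP_close_1:
  assumes "\<mu> \<in> Prob" "\<nu> \<in> Prob"
  shows "LP_close \<mu> \<nu> 1"
proof -
  interpret \<mu>: prob_space \<mu> using assms by (simp add: ProbD)
  interpret \<nu>: prob_space \<nu> using assms by (simp add: ProbD)
  have "measure \<mu> A \<le> measure \<nu> B + 1" "measure \<nu> A \<le> measure \<mu> B + 1" for A B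
    using \<mu>.prob_le_1[of A] \<nu>.prob_le_1[of A] by (simp_all add: add_increasing)
  then show ?thesis unfolding LP_close_def by simp
qed

lemma dLP_nonneg: "\<mu> \<in> Prob \<Longrightarrow> \<nu> \<in> Prob \<Longrightarrow> 0 \<le> dLP \<mu> \<nu>"
  unfolding dLP_alt by (rule cInf_greatest) (use LP_close_1[of \<mu> \<nu>] in blast, simp add: LP_close_def)

lemma dLP_lessD:
  assumes "\<mu> \<in> Prob" "\<nu> \<in> Prob" "dLP \<mu> \<nu> < c"
  shows "\<exists>e. LP_close \<mu> \<nu> e \<and> e < c"
  using cInf_lessD[of "{e. LP_close \<mu> \<nu> e}" c] LP_close_1[OF assms(1,2)] assms(3)
  unfolding dLP_alt by blast

lemma LP_close_trans:
  assumes P: "\<mu> \<in> Prob" "\<nu> \<in> Prob" "\<xi> \<in> Prob" and e: "LP_close \<mu> \<nu> e" and f: "LP_close \<nu> \<xi> f"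
  shows "LP_close \<mu> \<xi> (e + f)"
proof -
  have m: "measure \<eta> (enlarge (enlarge A r) s) \<le> measure \<eta> (enlarge A (r + s))" if "\<eta> \<in> Prob" for \<eta> A r s
  proof -
    interpret prob_space \<eta> using that by (simp add: ProbD)
    show ?thesis using that
      by (intro finite_measure_mono enlarge_enlarge) (simp add: ProbD open_enlarge)
  qed
  show ?thesis unfolding LP_close_def
  proof (intro conjI ballI)
    show "0 < e + f" using e f unfolding LP_close_def by simp
    fix A :: "'a set" assume A: "A \<in> sets borel"
    have "measure \<mu> A \<le> measure \<nu> (enlarge A e) + e" using e A unfolding LP_close_def by blast
    moreover have "measure \<nu> (enlarge A e) \<le> measure \<xi> (enlarge (enlarge A e) f) + f"
      using f enlarge_borel[of A e] unfolding LP_close_def by blast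
    ultimately show "measure \<mu> A \<le> measure \<xi> (enlarge A (e + f)) + (e + f)"
      using m[OF P(3), of A e f] by linarith
    have "measure \<xi> A \<le> measure \<nu> (enlarge A f) + f" using f A unfolding LP_close_def by blast
    moreover have "measure \<nu> (enlarge A f) \<le> measure \<mu> (enlarge (enlarge A f) e) + e"
      using e enlarge_borel[of A f] unfolding LP_close_def by blast
    ultimately show "measure \<xi> A \<le> measure \<mu> (enlarge A (e + f)) + (e + f)"
      using m[OF P(1), of A f e] by (simp add: add.commute[of f e])
  qed
qed

lemma dLP_triangle:
  assumes P: "\<mu> \<in> Prob" "\<nu> \<in> Prob" "\<xi> \<in> Prob"
  shows "dLP \<mu> \<xi> \<le> dLP \<mu> \<nu> + dLP \<nu> \<xi>"
proof (rule field_le_epsilon)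
  fix r :: real assume "0 < r"
  then obtain e f where e: "LP_close \<mu> \<nu> e" "e < dLP \<mu> \<nu> + r / 2" and f: "LP_close \<nu> \<xi> f" "f < dLP \<nu> \<xi> + r / 2"
    using dLP_lessD[OF P(1,2), of "dLP \<mu> \<nu> + r / 2"] dLP_lessD[OF P(2,3), of "dLP \<nu> \<xi> + r / 2"] by auto
  then show "dLP \<mu> \<xi> \<le> dLP \<mu> \<nu> + dLP \<nu> \<xi> + r"
    using dLP_le[OF LP_close_trans[OF P e(1) f(1)]] by linarith
qed

section \<open>Couplings and the Wasserstein distance\<close>

definition cost :: "real \<Rightarrow> ('a::polish_space \<times> 'a) measure \<Rightarrow> ennreal" where
  "cost p \<pi> = (\<integral>\<^sup>+ z. ennreal (dist (fst z) (snd z) powr p) \<partial>\<pi>)"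

lemma Wp_alt: "Wp p \<mu> \<nu> = enn2real (INF \<pi>\<in>couplings \<mu> \<nu>. cost p \<pi>) powr (1 / p)"
  by (simp add: Wp_def cost_def)

lemma couplingsD:
  assumes "\<pi> \<in> couplings \<mu> \<nu>"
  shows "sets \<pi> = sets borel" "prob_space \<pi>" "space \<pi> = UNIV"
    "distr \<pi> borel fst = \<mu>" "distr \<pi> borel snd = \<nu>"
  using assms sets_eq_imp_space_eq[of \<pi> borel] by (auto simp: couplings_def)

lemma emeasure_couplings:
  assumes "\<pi> \<in> couplings \<mu> \<nu>" "A \<in> sets borel"
  shows "emeasure \<mu> A = emeasure \<pi> {z. fst z \<in> A}" "emeasure \<nu> A = emeasure \<pi> {z. snd z \<in> A}"
proof -
  note c = couplingsD[OF assms(1)]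
  have [measurable_cong]: "sets \<pi> = sets borel" by (rule c(1))
  have "emeasure (distr \<pi> borel fst) A = emeasure \<pi> (fst -` A \<inter> space \<pi>)"
    by (rule emeasure_distr) (use assms(2) in \<open>auto simp: borel_prod[symmetric] measurable_cong_sets[OF c(1)]\<close>)
  moreover have "emeasure (distr \<pi> borel snd) A = emeasure \<pi> (snd -` A \<inter> space \<pi>)"
    by (rule emeasure_distr) (use assms(2) in \<open>auto simp: borel_prod[symmetric] measurable_cong_sets[OF c(1)]\<close>)
  ultimately show "emeasure \<mu> A = emeasure \<pi> {z. fst z \<in> A}" "emeasure \<nu> A = emeasure \<pi> {z. snd z \<in> A}"
    using c by (simp_all add: vimage_def)
qed

lemma sets_pair_Prob:
  fixes \<mu> :: "'a::polish_space measure" and \<nu> :: "'b::polish_space measure"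
  assumes "sets \<mu> = sets borel" "sets \<nu> = sets borel"
  shows "sets (\<mu> \<Otimes>\<^sub>M \<nu>) = sets borel"
  using sets_pair_measure_cong[OF assms] unfolding borel_prod .

lemma fst_borel [measurable]: "fst \<in> borel_measurable (borel :: ('a::second_countable_topology \<times> 'b::second_countable_topology) measure)"
  unfolding borel_prod[symmetric] by simp

lemma snd_borel [measurable]: "snd \<in> borel_measurable (borel :: ('a::second_countable_topology \<times> 'b::second_countable_topology) measure)"
  unfolding borel_prod[symmetric] by simp

lemma product_coupling:
  assumes "\<mu> \<in> Prob" "\<nu> \<in> Prob"
  shows "\<mu> \<Otimes>\<^sub>M \<nu> \<in> couplings \<mu> \<nu>"
proof -
  interpret \<mu>: prob_space \<mu> using assms by (simp add: ProbD)
  interpret \<nu>: prob_space \<nu> using assms by (simp add: ProbD)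
  interpret P: pair_prob_space \<mu> \<nu> ..
  note s = ProbD[OF assms(1)] ProbD[OF assms(2)]
  have "distr (\<mu> \<Otimes>\<^sub>M \<nu>) borel fst = \<mu>"
    using \<nu>.distr_pair_fst[of \<mu>] distr_cong[OF refl s(1)[symmetric], of "\<mu> \<Otimes>\<^sub>M \<nu>" fst fst] by simp
  moreover have "distr (\<mu> \<Otimes>\<^sub>M \<nu>) borel snd = \<nu>"
  proof (rule measure_eqI)
    fix A :: "'a set" assume "A \<in> sets (distr (\<mu> \<Otimes>\<^sub>M \<nu>) borel snd)"
    then have A: "A \<in> sets \<nu>" using s by simp
    have "emeasure (distr (\<mu> \<Otimes>\<^sub>M \<nu>) borel snd) A = emeasure (\<mu> \<Otimes>\<^sub>M \<nu>) (snd -` A \<inter> space (\<mu> \<Otimes>\<^sub>M \<nu>))"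
      by (rule emeasure_distr) (use A s in \<open>auto simp: measurable_cong_sets[OF refl s(4)[symmetric]]\<close>)
    also have "snd -` A \<inter> space (\<mu> \<Otimes>\<^sub>M \<nu>) = space \<mu> \<times> A" using s by (auto simp: space_pair_measure)
    also have "emeasure (\<mu> \<Otimes>\<^sub>M \<nu>) (space \<mu> \<times> A) = emeasure \<mu> (space \<mu>) * emeasure \<nu> A"
      using A by (intro \<nu>.emeasure_pair_measure_Times) auto
    finally show "emeasure (distr (\<mu> \<Otimes>\<^sub>M \<nu>) borel snd) A = emeasure \<nu> A" by (simp add: \<mu>.emeasure_space_1)
  qed (use s in simp)
  ultimately show ?thesis unfolding couplings_def
    using sets_pair_Prob[OF s(1) s(4)] P.prob_space_axioms by simp
qed

lemma powr_sum3_le: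
  fixes x y z p :: real
  assumes "0 \<le> x" "0 \<le> y" "0 \<le> z" "0 < p"
  shows "(x + y + z) powr p \<le> 3 powr p * (x powr p + y powr p + z powr p)"
proof -
  define w where "w = max x (max y z)"
  have "(x + y + z) powr p \<le> (3 * w) powr p" using assms unfolding w_def by (intro powr_mono2) auto
  also have "\<dots> = 3 powr p * w powr p" using assms unfolding w_def by (simp add: powr_mult)
  also have "w powr p \<le> x powr p + y powr p + z powr p"
    unfolding w_def max_def by (auto simp: add_increasing add_increasing2)
  finally show ?thesis by simp
qed

text \<open>\<open>enn2real\<close> sends infinity to 0, so a small value of \<open>Wp\<close>
  yields a cheap coupling only when the infimum is known to be finite; the product coupling shows
  that. The moments of the two measures come with their own base points, hence three distances in
  the estimate.\<close>

lemma cost_product_finite: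
  assumes "0 < p" "\<mu> \<in> Pp p" "\<nu> \<in> Pp p"
  shows "cost p (\<mu> \<Otimes>\<^sub>M \<nu>) < \<infinity>"
proof -
  have P: "\<mu> \<in> Prob" "\<nu> \<in> Prob" using assms by (auto simp: Pp_imp_Prob)
  obtain x0 where x0: "(\<integral>\<^sup>+ x. ennreal (dist x x0 powr p) \<partial>\<mu>) < \<infinity>" using assms(2) unfolding Pp_def by blast
  obtain y0 where y0: "(\<integral>\<^sup>+ x. ennreal (dist x y0 powr p) \<partial>\<nu>) < \<infinity>" using assms(3) unfolding Pp_def by blast
  interpret \<mu>: prob_space \<mu> using P by (simp add: ProbD)
  interpret \<nu>: prob_space \<nu> using P by (simp add: ProbD)
  interpret Q: pair_prob_space \<mu> \<nu> ..
  have [measurable_cong]: "sets \<mu> = sets borel" "sets \<nu> = sets borel" using P by (auto simp: ProbD)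
  define k where "k = ennreal (3 powr p)"
  have "cost p (\<mu> \<Otimes>\<^sub>M \<nu>) \<le> (\<integral>\<^sup>+ z. k * (ennreal (dist (fst z) x0 powr p) + ennreal (dist x0 y0 powr p) + ennreal (dist (snd z) y0 powr p)) \<partial>(\<mu> \<Otimes>\<^sub>M \<nu>))"
    unfolding cost_def
  proof (rule nn_integral_mono)
    fix z :: "'a \<times> 'a"
    have "dist (fst z) (snd z) \<le> dist (fst z) x0 + dist x0 y0 + dist (snd z) y0"
      using dist_triangle[of "fst z" "snd z" x0] dist_triangle[of x0 "snd z" y0] by (simp add: dist_commute)
    then have "dist (fst z) (snd z) powr p \<le> (dist (fst z) x0 + dist x0 y0 + dist (snd z) y0) powr p"
      using assms by (intro powr_mono2) auto
    also have "\<dots> \<le> 3 powr p * (dist (fst z) x0 powr p + dist x0 y0 powr p + dist (snd z) y0 powr p)"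
      using assms by (intro powr_sum3_le) auto
    finally show "ennreal (dist (fst z) (snd z) powr p) \<le> k * (ennreal (dist (fst z) x0 powr p) + ennreal (dist x0 y0 powr p) + ennreal (dist (snd z) y0 powr p))"
      unfolding k_def by (simp add: ennreal_plus[symmetric] ennreal_mult''[symmetric] ennreal_leI del: ennreal_plus)
  qed
  also have "\<dots> = k * ((\<integral>\<^sup>+ z. ennreal (dist (fst z) x0 powr p) \<partial>(\<mu> \<Otimes>\<^sub>M \<nu>)) + ennreal (dist x0 y0 powr p) + (\<integral>\<^sup>+ z. ennreal (dist (snd z) y0 powr p) \<partial>(\<mu> \<Otimes>\<^sub>M \<nu>)))"
    by (simp add: nn_integral_cmult nn_integral_add Q.emeasure_space_1)
  also have "(\<integral>\<^sup>+ z. ennreal (dist (fst z) x0 powr p) \<partial>(\<mu> \<Otimes>\<^sub>M \<nu>)) = (\<integral>\<^sup>+ x. ennreal (dist x x0 powr p) \<partial>\<mu>)"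
    by (subst \<nu>.nn_integral_fst[symmetric]) (simp_all add: \<nu>.emeasure_space_1)
  also have "(\<integral>\<^sup>+ z. ennreal (dist (snd z) y0 powr p) \<partial>(\<mu> \<Otimes>\<^sub>M \<nu>)) = (\<integral>\<^sup>+ x. ennreal (dist x y0 powr p) \<partial>\<nu>)"
    by (subst \<nu>.nn_integral_fst[symmetric]) (simp_all add: \<mu>.emeasure_space_1)
  also have "k * ((\<integral>\<^sup>+ x. ennreal (dist x x0 powr p) \<partial>\<mu>) + ennreal (dist x0 y0 powr p) + (\<integral>\<^sup>+ x. ennreal (dist x y0 powr p) \<partial>\<nu>)) < \<infinity>"
    using x0 y0 unfolding k_def by (simp add: ennreal_mult_less_top)
  finally show ?thesis .
qed

lemma Wp_lessD:
  assumes "0 < p" "\<mu> \<in> Pp p" "\<nu> \<in> Pp p" "Wp p \<mu> \<nu> < c"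
  obtains \<pi> where "\<pi> \<in> couplings \<mu> \<nu>" "cost p \<pi> < ennreal (c powr p)"
proof -
  define I where "I = (INF \<pi>\<in>couplings \<mu> \<nu>. cost p \<pi>)"
  have "0 < c" using assms(4) unfolding Wp_alt by (meson le_less_trans powr_ge_zero)
  have "I \<le> cost p (\<mu> \<Otimes>\<^sub>M \<nu>)" unfolding I_def
    using assms by (intro INF_lower product_coupling) (auto simp: Pp_imp_Prob)
  then have fin: "I < \<infinity>" using cost_product_finite[OF assms(1-3)] by (rule le_less_trans)
  have "enn2real I = (enn2real I powr (1 / p)) powr p" using assms(1) by (simp add: powr_powr)
  also have "\<dots> < c powr p" using assms unfolding Wp_alt I_def by (intro powr_less_mono2) auto
  finally have "I < ennreal (c powr p)" using fin by (simp add: enn2real_less_iff less_top)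
  then show ?thesis using that unfolding I_def INF_less_iff by blast
qed

lemma Wp_le:
  assumes "0 < p" "\<pi> \<in> couplings \<mu> \<nu>" "cost p \<pi> \<le> ennreal (c powr p)" "0 \<le> c"
  shows "Wp p \<mu> \<nu> \<le> c"
proof -
  have "(INF \<pi>\<in>couplings \<mu> \<nu>. cost p \<pi>) \<le> ennreal (c powr p)"
    using assms by (meson INF_lower order_trans)
  then have "enn2real (INF \<pi>\<in>couplings \<mu> \<nu>. cost p \<pi>) \<le> c powr p"
    by (simp add: enn2real_leI)
  then have "Wp p \<mu> \<nu> \<le> (c powr p) powr (1 / p)"
    unfolding Wp_alt using assms(1) by (intro powr_mono2) auto
  also have "\<dots> = c" using assms by (simp add: powr_powr)
  finally show ?thesis .
qed

lemma Wp_nonneg: "0 \<le> Wp p \<mu> \<nu>"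
  by (simp add: Wp_def)

lemma coupling_swap:
  assumes "\<pi> \<in> couplings \<mu> \<nu>"
  shows "distr \<pi> borel (\<lambda>z. (snd z, fst z)) \<in> couplings \<nu> \<mu>"
    "cost p (distr \<pi> borel (\<lambda>z. (snd z, fst z))) = cost p \<pi>"
proof -
  note c = couplingsD[OF assms]
  have [measurable_cong]: "sets \<pi> = sets borel" by (rule c(1))
  interpret prob_space \<pi> by (rule c(2))
  have sw [measurable]: "(\<lambda>z. (snd z, fst z)) \<in> borel_measurable \<pi>"
    unfolding borel_prod[symmetric] by (intro measurable_Pair) measurable
  show "distr \<pi> borel (\<lambda>z. (snd z, fst z)) \<in> couplings \<nu> \<mu>"
    unfolding couplings_def using c
    by (auto simp: prob_space_distr distr_distr comp_def)
  have [measurable]: "(\<lambda>z::'a \<times> 'a. ennreal (dist (fst z) (snd z) powr p)) \<in> borel_measurable borel"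
    by measurable
  show "cost p (distr \<pi> borel (\<lambda>z. (snd z, fst z))) = cost p \<pi>"
    unfolding cost_def by (subst nn_integral_distr) (simp_all add: dist_commute)
qed

lemma Wp_commute: "Wp p \<mu> \<nu> = Wp p \<nu> \<mu>"
proof -
  have "(INF \<pi>\<in>couplings \<mu> \<nu>. cost p \<pi>) \<le> (INF \<pi>\<in>couplings \<nu> \<mu>. cost p \<pi>)" for \<mu> \<nu> :: "'a measure"
  proof (rule INF_greatest)
    fix \<pi> assume "\<pi> \<in> couplings \<nu> \<mu>"
    then show "(INF \<pi>\<in>couplings \<mu> \<nu>. cost p \<pi>) \<le> cost p \<pi>"
      using INF_lower[OF coupling_swap(1), of \<pi> \<nu> \<mu> "cost p"] by (simp add: coupling_swap(2))
  qed
  from antisym[OF this this] show ?thesis unfolding Wp_alt by simp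
qed

lemma Wp_self:
  assumes "0 < p" "\<mu> \<in> Prob"
  shows "Wp p \<mu> \<mu> = 0"
proof -
  note s = ProbD[OF assms(2)]
  interpret prob_space \<mu> by (rule s)
  have [measurable_cong]: "sets \<mu> = sets borel" by (rule s(1))
  have [measurable]: "(\<lambda>x. (x, x)) \<in> borel_measurable \<mu>"
    unfolding borel_prod[symmetric] by (intro measurable_Pair) auto
  have [measurable]: "(\<lambda>z::'a \<times> 'a. ennreal (dist (fst z) (snd z) powr p)) \<in> borel_measurable borel"
    by measurable
  have "distr \<mu> borel (\<lambda>x. x) = \<mu>"
    using distr_cong[OF refl s(1)[symmetric], of \<mu> "\<lambda>x. x" "\<lambda>x. x"] by (simp add: distr_id2)
  then have "distr \<mu> borel (\<lambda>x. (x, x)) \<in> couplings \<mu> \<mu>"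
    unfolding couplings_def by (auto simp: prob_space_distr distr_distr comp_def)
  moreover have "cost p (distr \<mu> borel (\<lambda>x. (x, x))) = 0"
    unfolding cost_def by (subst nn_integral_distr) simp_all
  ultimately have "Wp p \<mu> \<mu> \<le> 0" using assms by (intro Wp_le) auto
  then show ?thesis using Wp_nonneg[of p \<mu> \<mu>] by simp
qed

text \<open>Markov's inequality for the coupling: a cost below \<open>e powr (p + 1)\<close> leaves
  mass less than \<open>e\<close> where the coordinates are at least \<open>e\<close> apart, and
  elsewhere one coordinate in \<open>A\<close> puts the other into \<open>enlarge A e\<close>.
  Taking the \<open>p\<close>-th root explains the exponent \<open>(p + 1) / p\<close>.\<close>

lemma Wp_small_imp_LP_close:
  assumes p: "0 < p" and P: "\<mu> \<in> Pp p" "\<nu> \<in> Pp p" and e: "0 < e" "Wp p \<mu> \<nu> < e powr ((p + 1) / p)"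
  shows "LP_close \<mu> \<nu> e"
proof -
  obtain \<pi> where \<pi>: "\<pi> \<in> couplings \<mu> \<nu>" "cost p \<pi> < ennreal ((e powr ((p + 1) / p)) powr p)"
    using Wp_lessD[OF p P e(2)] .
  note c = couplingsD[OF \<pi>(1)]
  interpret prob_space \<pi> by (rule c)
  have [measurable_cong]: "sets \<pi> = sets borel" by (rule c(1))
  define S where "S = {z. e \<le> dist (fst z) (snd z :: 'a)}"
  have S [measurable]: "S \<in> sets borel"
    unfolding S_def by (intro borel_closed closed_Collect_le continuous_intros)
  have "ennreal (e powr p) * emeasure \<pi> S = (\<integral>\<^sup>+ z. ennreal (e powr p) * indicator S z \<partial>\<pi>)"
    using S by (simp add: nn_integral_cmult_indicator c(1))
  also have "\<dots> \<le> cost p \<pi>" unfolding cost_def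
    using e p by (intro nn_integral_mono) (auto simp: S_def indicator_def intro!: ennreal_leI powr_mono2)
  also have "\<dots> < ennreal (e powr (p + 1))" using \<pi>(2) p by (simp add: powr_powr)
  finally have "e powr p * prob S < e powr (p + 1)"
    by (simp add: emeasure_eq_measure ennreal_mult'[symmetric] ennreal_less_iff)
  then have "e powr p * prob S < e powr p * e" using e by (simp add: powr_add)
  then have PS: "prob S < e" using e by simp
  have mm: "measure \<mu> A = prob {z. fst z \<in> A}" "measure \<nu> A = prob {z. snd z \<in> A}" if "A \<in> sets borel" for A
    using emeasure_couplings[OF \<pi>(1) that] by (simp_all add: measure_def)
  have meas: "{z. fst z \<in> A} \<in> sets \<pi>" "{z. snd z \<in> A} \<in> sets \<pi>" if "A \<in> sets borel" for A :: "'a set"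
    using measurable_sets[OF fst_borel that] measurable_sets[OF snd_borel that] c(1) by (simp_all add: vimage_def)
  show ?thesis unfolding LP_close_def
  proof (intro conjI ballI)
    fix A :: "'a set" assume A: "A \<in> sets borel"
    have en: "enlarge A e \<in> sets borel" by (rule enlarge_borel)
    have "{z. fst z \<in> A} \<subseteq> {z. snd z \<in> enlarge A e} \<union> S"
      unfolding S_def enlarge_def by (auto simp: not_le) (metis dist_commute)
    then have "prob {z. fst z \<in> A} \<le> prob ({z. snd z \<in> enlarge A e} \<union> S)"
      using meas[OF A] meas[OF en] S c(1) by (intro finite_measure_mono) auto
    also have "\<dots> \<le> prob {z. snd z \<in> enlarge A e} + prob S"
      using meas[OF en] S c(1) by (intro measure_Un_le) auto
    finally show "measure \<mu> A \<le> measure \<nu> (enlarge A e) + e"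
      using PS mm[OF A] mm[OF en] by simp
    have "prob {z. snd z \<in> A} \<le> prob ({z. fst z \<in> enlarge A e} \<union> S)"
      using meas[OF A] meas[OF en] S c(1)
      by (intro finite_measure_mono) (auto simp: S_def enlarge_def not_le)
    also have "\<dots> \<le> prob {z. fst z \<in> enlarge A e} + prob S"
      using meas[OF en] S c(1) by (intro measure_Un_le) auto
    finally show "measure \<nu> A \<le> measure \<mu> (enlarge A e) + e"
      using PS mm[OF A] mm[OF en] by simp
  qed (rule e)
qed

lemma Wp_tendsto_imp_dLP_tendsto:
  assumes p: "0 < p" and P: "\<And>n. \<mu> n \<in> Pp p" "\<And>n. \<nu> n \<in> Pp p"
    and W: "(\<lambda>n. Wp p (\<mu> n) (\<nu> n)) \<longlonglongrightarrow> 0"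
  shows "(\<lambda>n. dLP (\<mu> n) (\<nu> n)) \<longlonglongrightarrow> 0"
proof (rule LIMSEQ_I)
  fix r :: real assume "0 < r"
  define e where "e = r / 2"
  have e: "0 < e" "e < r" using \<open>0 < r\<close> by (auto simp: e_def)
  obtain N where N: "\<And>n. n \<ge> N \<Longrightarrow> norm (Wp p (\<mu> n) (\<nu> n) - 0) < e powr ((p + 1) / p)"
    using LIMSEQ_D[OF W, of "e powr ((p + 1) / p)"] e by auto
  have "norm (dLP (\<mu> n) (\<nu> n) - 0) < r" if "n \<ge> N" for n
    using dLP_le[OF Wp_small_imp_LP_close[OF p P(1)[of n] P(2)[of n] e(1)]] N[OF that] e
      dLP_nonneg[OF Pp_imp_Prob[OF P(1)] Pp_imp_Prob[OF P(2)], of n n] by fastforce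
  then show "\<exists>N. \<forall>n\<ge>N. norm (dLP (\<mu> n) (\<nu> n) - 0) < r" by blast
qed

section \<open>Approximate gluing and the triangle inequality\<close>

text \<open>A point is sent to the index of the first point of a countable dense sequence within
  distance \<open>r / 2\<close>. Taking the least index makes the cells disjoint and the index
  measurable.\<close>

lemma countable_cells:
  fixes r :: real
  assumes "0 < r"
  obtains i :: "'a::polish_space \<Rightarrow> nat" where "i \<in> measurable borel (count_space UNIV)"
    "\<And>x y. i x = i y \<Longrightarrow> dist x y < r"
proof -
  obtain X :: "'a set" where X: "countable X" "\<And>U. open U \<Longrightarrow> U \<noteq> {} \<Longrightarrow> \<exists>d\<in>X. d \<in> U"
    by (rule countable_dense_setE) blast
  define D where "D = from_nat_into X"
  define i where "i y = (LEAST n. dist y (D n) < r / 2)" for y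
  have ex: "\<exists>n. dist y (D n) < r / 2" for y
  proof -
    have "ball y (r / 2) \<noteq> {}" using assms by simp
    then obtain d where "d \<in> X" "d \<in> ball y (r / 2)" using X(2)[OF open_ball] by blast
    then show ?thesis unfolding D_def using from_nat_into_surj[OF X(1)] by (metis mem_ball)
  qed
  have near: "dist y (D (i y)) < r / 2" for y unfolding i_def using ex by (rule LeastI_ex)
  show ?thesis
  proof
    show "i \<in> measurable borel (count_space UNIV)" unfolding i_def by measurable
    show "dist x y < r" if "i x = i y" for x y
      using near[of x] near[of y] that dist_triangle2[of x y "D (i x)"] by auto
  qed
qed

text \<open>Gluing without disintegration: the two couplings are made conditionally independent given the
  cell of a countable partition containing the middle coordinate, so that the two middle
  coordinates agree only up to the mesh \<open>r\<close>.\<close>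

lemma approximate_gluing:
  fixes \<pi>1 \<pi>2 :: "('a::polish_space \<times> 'a) measure"
  assumes \<pi>1: "\<pi>1 \<in> couplings \<mu> \<nu>" and \<pi>2: "\<pi>2 \<in> couplings \<nu> \<xi>" and "0 < r"
  obtains \<Gamma> where "sets \<Gamma> = sets (borel \<Otimes>\<^sub>M borel)" "distr \<Gamma> borel fst = \<pi>1" "distr \<Gamma> borel snd = \<pi>2"
    "AE \<omega> in \<Gamma>. dist (snd (fst \<omega>)) (fst (snd \<omega>)) < r"
proof -
  note c1 = couplingsD[OF \<pi>1] and c2 = couplingsD[OF \<pi>2]
  have [measurable_cong]: "sets \<pi>1 = sets borel" by (rule c1)
  have [measurable_cong]: "sets \<pi>2 = sets borel" by (rule c2)
  interpret P1: prob_space \<pi>1 by (rule c1)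
  interpret P2: prob_space \<pi>2 by (rule c2)
  interpret P: pair_prob_space \<pi>1 \<pi>2 ..
  obtain i :: "'a \<Rightarrow> nat" where i [measurable]: "i \<in> measurable borel (count_space UNIV)"
    and close: "\<And>x y. i x = i y \<Longrightarrow> dist x y < r"
    using countable_cells[OF \<open>0 < r\<close>] by blast
  define h where "h n = emeasure \<nu> {y. i y = n}" for n
  \<comment> \<open>Under the product measure both middle coordinates fall into cell
    \<open>n\<close> with probability \<open>h n * h n\<close>. The density
    \<open>inverse (h n)\<close> turns this into \<open>h n\<close>, the mass that each coupling
    gives to that cell, and so restores both marginals.\<close>
  define k where "k \<omega> = (if i (snd (fst \<omega>)) = i (fst (snd \<omega>)) then inverse (h (i (snd (fst \<omega>)))) else 0)"
    for \<omega> :: "('a \<times> 'a) \<times> ('a \<times> 'a)"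
  have cell: "{y. i y = n} \<in> sets borel" for n
    using measurable_sets[OF i, of "{n}"] by (simp add: vimage_def)
  have cell2: "{z :: 'a \<times> 'a. i (fst z) = n} \<in> sets borel" "{z :: 'a \<times> 'a. i (snd z) = n} \<in> sets borel" for n
    using measurable_sets[OF fst_borel cell[of n]] measurable_sets[OF snd_borel cell[of n]]
    by (simp_all add: vimage_def)
  have h1: "emeasure \<pi>1 {z. i (snd z) = n} = h n" and h2: "emeasure \<pi>2 {z. i (fst z) = n} = h n" for n
    using emeasure_couplings(2)[OF \<pi>1 cell[of n]] emeasure_couplings(1)[OF \<pi>2 cell[of n]]
    by (simp_all add: h_def)
  have hfin: "h n < top" for n unfolding h1[symmetric] by (simp add: less_top[symmetric])
  have [measurable]: "h \<in> borel_measurable (count_space UNIV)" by simp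
  have m1: "(\<lambda>\<omega> :: ('a \<times> 'a) \<times> ('a \<times> 'a). i (snd (fst \<omega>))) \<in> measurable (borel \<Otimes>\<^sub>M borel) (count_space UNIV)"
    by (rule measurable_compose[OF measurable_compose[OF measurable_fst snd_borel] i])
  have m2: "(\<lambda>\<omega> :: ('a \<times> 'a) \<times> ('a \<times> 'a). i (fst (snd \<omega>))) \<in> measurable (borel \<Otimes>\<^sub>M borel) (count_space UNIV)"
    by (rule measurable_compose[OF measurable_compose[OF measurable_snd fst_borel] i])
  have "(\<lambda>\<omega>. if f \<omega> = g \<omega> then inverse (h (f \<omega>)) else 0) \<in> borel_measurable M"
    if f [measurable]: "f \<in> measurable M (count_space UNIV)" and [measurable]: "g \<in> measurable M (count_space UNIV)"
    for f g and M :: "'b measure"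
  proof (rule measurable_If)
    show "(\<lambda>\<omega>. inverse (h (f \<omega>))) \<in> borel_measurable M" by (rule measurable_compose[OF f]) simp
    have "Measurable.pred M (\<lambda>\<omega>. \<exists>n. f \<omega> = n \<and> g \<omega> = n)" by measurable
    then show "{\<omega> \<in> space M. f \<omega> = g \<omega>} \<in> sets M" by (simp add: pred_def eq_commute)
  qed simp
  from this[OF m1 m2] have [measurable]: "k \<in> borel_measurable (borel \<Otimes>\<^sub>M borel)"
    unfolding k_def .
  have kp: "k \<in> borel_measurable (\<pi>1 \<Otimes>\<^sub>M \<pi>2)" by measurable
  define \<Gamma> where "\<Gamma> = density (\<pi>1 \<Otimes>\<^sub>M \<pi>2) k"
  have s\<Gamma> [measurable_cong]: "sets \<Gamma> = sets (borel \<Otimes>\<^sub>M borel)"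
    unfolding \<Gamma>_def using sets_pair_measure_cong[OF c1(1) c2(1)] by simp
  have sp: "space (\<pi>1 \<Otimes>\<^sub>M \<pi>2) = UNIV" using c1 c2 by (simp add: space_pair_measure)
  have s\<Gamma>': "space \<Gamma> = UNIV" unfolding \<Gamma>_def using sp by simp
  have one: "inverse (h n) * h n = 1" if "h n \<noteq> 0" for n
    using ennreal_divide_self[OF that] hfin[of n] by (simp add: divide_ennreal_def mult.commute)
  \<comment> \<open>Cells of mass zero, where \<open>inverse (h n)\<close> is infinite, are met with
    probability zero.\<close>
  have "AE y in \<nu>. h (i y) \<noteq> 0"
  proof -
    have sN: "sets \<nu> = sets borel" using c1 by (metis sets_distr)
    have "AE y in \<nu>. h n = 0 \<longrightarrow> i y \<noteq> n" for n
    proof (cases "h n = 0")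
      case True
      then have "{y. i y = n} \<in> null_sets \<nu>" using cell sN unfolding h_def null_sets_def by auto
      then show ?thesis by (rule AE_I') auto
    qed simp
    then have "AE y in \<nu>. \<forall>n. h n = 0 \<longrightarrow> i y \<noteq> n" by (simp add: AE_all_countable)
    then show ?thesis by eventually_elim auto
  qed
  then have ae: "AE y in distr \<pi>1 borel snd. h (i y) \<noteq> 0" "AE y in distr \<pi>2 borel fst. h (i y) \<noteq> 0"
    unfolding c1(5) c2(4) by assumption+
  have ae1: "AE z in \<pi>1. h (i (snd z)) \<noteq> 0" by (rule AE_distrD[OF _ ae(1)]) measurable
  have ae2: "AE z in \<pi>2. h (i (fst z)) \<noteq> 0" by (rule AE_distrD[OF _ ae(2)]) measurable
  have d1: "distr \<Gamma> borel fst = \<pi>1"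
  proof (rule measure_eqI)
    fix A :: "('a \<times> 'a) set" assume "A \<in> sets (distr \<Gamma> borel fst)"
    then have A [measurable]: "A \<in> sets borel" by simp
    have "emeasure (distr \<Gamma> borel fst) A = emeasure \<Gamma> (fst -` A)"
      by (subst emeasure_distr) (auto simp: s\<Gamma>')
    also have "\<dots> = (\<integral>\<^sup>+\<omega>. k \<omega> * indicator A (fst \<omega>) \<partial>(\<pi>1 \<Otimes>\<^sub>M \<pi>2))"
    proof -
      have "fst -` A \<inter> space (\<pi>1 \<Otimes>\<^sub>M \<pi>2) \<in> sets (\<pi>1 \<Otimes>\<^sub>M \<pi>2)" by measurable
      then show ?thesis unfolding \<Gamma>_def sp
        by (subst emeasure_density) (auto simp: kp indicator_def intro!: nn_integral_cong)
    qed
    also have "\<dots> = (\<integral>\<^sup>+z. (\<integral>\<^sup>+w. k (z, w) * indicator A z \<partial>\<pi>2) \<partial>\<pi>1)"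
      by (subst P2.nn_integral_fst[symmetric]) simp_all
    also have "\<dots> = (\<integral>\<^sup>+z. indicator A z \<partial>\<pi>1)"
    proof (rule nn_integral_cong_AE, use ae1 in eventually_elim)
      fix z :: "'a \<times> 'a" assume z: "h (i (snd z)) \<noteq> 0"
      have "(\<integral>\<^sup>+w. k (z, w) * indicator A z \<partial>\<pi>2)
          = (\<integral>\<^sup>+w. (inverse (h (i (snd z))) * indicator A z) * indicator {w. i (fst w) = i (snd z)} w \<partial>\<pi>2)"
        by (intro nn_integral_cong) (auto simp: k_def indicator_def)
      also have "\<dots> = (inverse (h (i (snd z))) * indicator A z) * h (i (snd z))"
        by (subst nn_integral_cmult_indicator) (auto simp: h2 c2(1) cell2)
      also have "\<dots> = indicator A z" using one[OF z] by (simp add: mult.assoc mult.left_commute)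
      finally show "(\<integral>\<^sup>+w. k (z, w) * indicator A z \<partial>\<pi>2) = indicator A z" .
    qed
    also have "\<dots> = emeasure \<pi>1 A" by simp
    finally show "emeasure (distr \<Gamma> borel fst) A = emeasure \<pi>1 A" .
  qed (simp add: c1)
  have d2: "distr \<Gamma> borel snd = \<pi>2"
  proof (rule measure_eqI)
    fix A :: "('a \<times> 'a) set" assume "A \<in> sets (distr \<Gamma> borel snd)"
    then have A [measurable]: "A \<in> sets borel" by simp
    have "emeasure (distr \<Gamma> borel snd) A = emeasure \<Gamma> (snd -` A)"
      by (subst emeasure_distr) (auto simp: s\<Gamma>')
    also have "\<dots> = (\<integral>\<^sup>+\<omega>. k \<omega> * indicator A (snd \<omega>) \<partial>(\<pi>1 \<Otimes>\<^sub>M \<pi>2))"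
    proof -
      have "snd -` A \<inter> space (\<pi>1 \<Otimes>\<^sub>M \<pi>2) \<in> sets (\<pi>1 \<Otimes>\<^sub>M \<pi>2)" by measurable
      then show ?thesis unfolding \<Gamma>_def sp
        by (subst emeasure_density) (auto simp: kp indicator_def intro!: nn_integral_cong)
    qed
    also have "\<dots> = (\<integral>\<^sup>+w. (\<integral>\<^sup>+z. k (z, w) * indicator A w \<partial>\<pi>1) \<partial>\<pi>2)"
      by (subst P.nn_integral_snd[symmetric]) simp_all
    also have "\<dots> = (\<integral>\<^sup>+w. indicator A w \<partial>\<pi>2)"
    proof (rule nn_integral_cong_AE, use ae2 in eventually_elim)
      fix w :: "'a \<times> 'a" assume w: "h (i (fst w)) \<noteq> 0"
      have "(\<integral>\<^sup>+z. k (z, w) * indicator A w \<partial>\<pi>1)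
          = (\<integral>\<^sup>+z. (inverse (h (i (fst w))) * indicator A w) * indicator {z. i (snd z) = i (fst w)} z \<partial>\<pi>1)"
        by (intro nn_integral_cong) (auto simp: k_def indicator_def)
      also have "\<dots> = (inverse (h (i (fst w))) * indicator A w) * h (i (fst w))"
        by (subst nn_integral_cmult_indicator) (auto simp: h1 c1(1) cell2)
      also have "\<dots> = indicator A w" using one[OF w] by (simp add: mult.assoc mult.left_commute)
      finally show "(\<integral>\<^sup>+z. k (z, w) * indicator A w \<partial>\<pi>1) = indicator A w" .
    qed
    also have "\<dots> = emeasure \<pi>2 A" by simp
    finally show "emeasure (distr \<Gamma> borel snd) A = emeasure \<pi>2 A" .
  qed (simp add: c2)
  have "AE \<omega> in \<Gamma>. dist (snd (fst \<omega>)) (fst (snd \<omega>)) < r"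
    unfolding \<Gamma>_def AE_density[OF kp] by (rule AE_I2) (auto simp: k_def close split: if_splits)
  then show ?thesis using that s\<Gamma> d1 d2 by blast
qed

lemma convex_on_powr:
  assumes "1 \<le> (p::real)"
  shows "convex_on {0..} (\<lambda>x. x powr p)"
proof (rule convex_on_linorderI)
  fix t x y :: real
  assume t: "0 < t" "t < 1" and xy: "x \<in> {0..}" "y \<in> {0..}" "x < y"
  show "((1 - t) *\<^sub>R x + t *\<^sub>R y) powr p \<le> (1 - t) * x powr p + t * y powr p"
  proof (cases "x = 0")
    case True
    have "t powr p \<le> t powr 1" using t assms by (intro powr_mono') auto
    then have "t powr p * y powr p \<le> t * y powr p" using t by (intro mult_right_mono) auto
    then show ?thesis using True t xy by (simp add: powr_mult)
  next
    case False
    then show ?thesis using convex_onD[OF powr_convex[OF assms], of t x y] t xy by auto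
  qed
qed simp

text \<open>Jensen's inequality for the ratios \<open>a / A\<close>, \<open>b / B\<close>,
  \<open>c / C\<close> with weights proportional to \<open>A\<close>, \<open>B\<close>,
  \<open>C\<close>. Integrated with \<open>A\<close>, \<open>B\<close>, \<open>C\<close> bounding
  the respective norms, it gives Minkowski's inequality.\<close>

lemma powr_sum3_convex:
  fixes A B C a b c p :: real
  assumes "1 \<le> p" "0 < A" "0 < B" "0 < C" "0 \<le> a" "0 \<le> b" "0 \<le> c"
  defines "S \<equiv> A + B + C"
  shows "(a + b + c) powr p \<le>
    S powr p * (A / S * (a powr p / A powr p) + B / S * (b powr p / B powr p) + C / S * (c powr p / C powr p))"
proof -
  have S: "0 < S" using assms by simp
  let ?w = "\<lambda>i::nat. if i = 0 then A / S else if i = 1 then B / S else C / S"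
  let ?y = "\<lambda>i::nat. if i = 0 then a / A else if i = 1 then b / B else c / C"
  have "(\<lambda>x. x powr p) (\<Sum>i\<in>{0,1,2::nat}. ?w i *\<^sub>R ?y i) \<le> (\<Sum>i\<in>{0,1,2::nat}. ?w i * (?y i) powr p)"
  proof (rule convex_on_sum[OF _ _ convex_on_powr[OF assms(1)]])
    have "A / S + B / S + C / S = 1" using S by (simp add: S_def add_divide_distrib[symmetric])
    then show "(\<Sum>i\<in>{0,1,2::nat}. ?w i) = 1" by simp
  qed (use assms S in auto)
  moreover have "(\<Sum>i\<in>{0,1,2::nat}. ?w i *\<^sub>R ?y i) = (a + b + c) / S"
    using assms(2-4) S by (simp add: add_divide_distrib)
  ultimately have "((a + b + c) / S) powr p \<le> A / S * (a / A) powr p + B / S * (b / B) powr p + C / S * (c / C) powr p"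
    by (simp add: add.assoc)
  also have "\<dots> = A / S * (a powr p / A powr p) + B / S * (b powr p / B powr p) + C / S * (c powr p / C powr p)"
    using assms by (simp add: powr_divide)
  finally have *: "((a + b + c) / S) powr p \<le> \<dots>" .
  have "(a + b + c) powr p = S powr p * ((a + b + c) / S) powr p"
    using S assms by (simp add: powr_divide)
  also have "\<dots> \<le> S powr p * (A / S * (a powr p / A powr p) + B / S * (b powr p / B powr p) + C / S * (c powr p / C powr p))"
    using * by (intro mult_left_mono) auto
  finally show ?thesis .
qed

lemma Wp_triangle:
  assumes p: "1 \<le> p" and P: "\<mu> \<in> Pp p" "\<nu> \<in> Pp p" "\<xi> \<in> Pp p"
  shows "Wp p \<mu> \<xi> \<le> Wp p \<mu> \<nu> + Wp p \<nu> \<xi>"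
proof (rule field_le_epsilon)
  fix e :: real assume "0 < e"
  \<comment> \<open>The slack \<open>e\<close> is shared by three terms: one \<open>r\<close> for
    each nearly optimal coupling and one for the mesh of the gluing.\<close>
  define r where "r = e / 3"
  define A where "A = Wp p \<mu> \<nu> + r"
  define B where "B = Wp p \<nu> \<xi> + r"
  define S where "S = A + r + B"
  have pos: "0 < r" "0 < A" "0 < B" "0 < S" "0 < p" and SS: "S = Wp p \<mu> \<nu> + Wp p \<nu> \<xi> + e"
    unfolding S_def A_def B_def r_def using \<open>0 < e\<close> p Wp_nonneg[of p \<mu> \<nu>] Wp_nonneg[of p \<nu> \<xi>]
    by (auto simp: add_pos_pos add_nonneg_pos)
  obtain \<pi>1 where \<pi>1: "\<pi>1 \<in> couplings \<mu> \<nu>" "cost p \<pi>1 < ennreal (A powr p)"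
    using Wp_lessD[OF pos(5) P(1,2), of A] pos by (auto simp: A_def)
  obtain \<pi>2 where \<pi>2: "\<pi>2 \<in> couplings \<nu> \<xi>" "cost p \<pi>2 < ennreal (B powr p)"
    using Wp_lessD[OF pos(5) P(2,3), of B] pos by (auto simp: B_def)
  obtain \<Gamma> where \<Gamma>: "sets \<Gamma> = sets (borel \<Otimes>\<^sub>M borel)" "distr \<Gamma> borel fst = \<pi>1" "distr \<Gamma> borel snd = \<pi>2"
    "AE \<omega> in \<Gamma>. dist (snd (fst \<omega>)) (fst (snd \<omega>)) < r"
    using approximate_gluing[OF \<pi>1(1) \<pi>2(1) pos(1)] .
  note c1 = couplingsD[OF \<pi>1(1)] and c2 = couplingsD[OF \<pi>2(1)]
  have [measurable_cong]: "sets \<Gamma> = sets (borel \<Otimes>\<^sub>M borel)" by (rule \<Gamma>)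
  have mf [measurable]: "fst \<in> measurable \<Gamma> borel" and ms [measurable]: "snd \<in> measurable \<Gamma> borel" by measurable
  note [measurable] = measurable_compose[OF mf fst_borel] measurable_compose[OF mf snd_borel]
    measurable_compose[OF ms fst_borel] measurable_compose[OF ms snd_borel]
  interpret G: prob_space \<Gamma>
    by (rule prob_space_distrD[OF mf]) (use c1 \<Gamma> in simp)
  have mt [measurable]: "(\<lambda>\<omega>. (fst (fst \<omega>), snd (snd \<omega>))) \<in> measurable \<Gamma> borel"
    unfolding borel_prod[symmetric] by measurable
  define \<pi> where "\<pi> = distr \<Gamma> borel (\<lambda>\<omega>. (fst (fst \<omega>), snd (snd \<omega>)))"
  have "distr \<pi> borel fst = distr (distr \<Gamma> borel fst) borel fst" "distr \<pi> borel snd = distr (distr \<Gamma> borel snd) borel snd"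
    unfolding \<pi>_def by (simp_all add: distr_distr comp_def)
  then have \<pi>: "\<pi> \<in> couplings \<mu> \<xi>"
    unfolding couplings_def using \<Gamma> c1 c2 G.prob_space_distr[OF mt] by (simp add: \<pi>_def)
  have md [measurable]: "(\<lambda>z::'a \<times> 'a. ennreal (dist (fst z) (snd z) powr p)) \<in> borel_measurable borel"
    by measurable
  \<comment> \<open>The coefficients from Jensen's inequality. Since the two costs are below
    \<open>A powr p\<close> and \<open>B powr p\<close>, the weighted total is at most
    \<open>S powr p\<close>.\<close>
  define k1 where "k1 = S powr p * (A / S) / A powr p"
  define k0 where "k0 = S powr p * (r / S)"
  define k2 where "k2 = S powr p * (B / S) / B powr p"
  have k: "0 \<le> k1" "0 \<le> k0" "0 \<le> k2" unfolding k1_def k0_def k2_def using pos by auto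
  have "cost p \<pi> = (\<integral>\<^sup>+\<omega>. ennreal (dist (fst (fst \<omega>)) (snd (snd \<omega>)) powr p) \<partial>\<Gamma>)"
    unfolding cost_def \<pi>_def by (subst nn_integral_distr) simp_all
  also have "\<dots> \<le> (\<integral>\<^sup>+\<omega>. ennreal k1 * ennreal (dist (fst (fst \<omega>)) (snd (fst \<omega>)) powr p) + ennreal k0
      + ennreal k2 * ennreal (dist (fst (snd \<omega>)) (snd (snd \<omega>)) powr p) \<partial>\<Gamma>)"
  proof (rule nn_integral_mono_AE, use \<Gamma>(4) in eventually_elim)
    fix \<omega> :: "('a \<times> 'a) \<times> ('a \<times> 'a)"
    obtain x y y' z where \<omega>: "\<omega> = ((x, y), (y', z))" by (metis prod.collapse)
    assume "dist (snd (fst \<omega>)) (fst (snd \<omega>)) < r"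
    then have "dist x z \<le> dist x y + r + dist y' z"
      using dist_triangle[of x z y] dist_triangle[of y z y'] \<omega> by simp
    then have "dist x z powr p \<le> (dist x y + r + dist y' z) powr p" using pos by (intro powr_mono2) auto
    also have "\<dots> \<le> S powr p * (A / S * (dist x y powr p / A powr p) + r / S * (r powr p / r powr p)
        + B / S * (dist y' z powr p / B powr p))"
      unfolding S_def using p pos by (intro powr_sum3_convex) auto
    also have "\<dots> = k1 * dist x y powr p + k0 + k2 * dist y' z powr p"
      unfolding k1_def k0_def k2_def using pos by (simp add: algebra_simps)
    finally show "ennreal (dist (fst (fst \<omega>)) (snd (snd \<omega>)) powr p) \<le>
        ennreal k1 * ennreal (dist (fst (fst \<omega>)) (snd (fst \<omega>)) powr p) + ennreal k0
        + ennreal k2 * ennreal (dist (fst (snd \<omega>)) (snd (snd \<omega>)) powr p)"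
      using k by (simp add: \<omega> ennreal_mult'[symmetric] ennreal_plus[symmetric] ennreal_leI del: ennreal_plus)
  qed
  also have "\<dots> = ennreal k1 * (\<integral>\<^sup>+\<omega>. ennreal (dist (fst (fst \<omega>)) (snd (fst \<omega>)) powr p) \<partial>\<Gamma>) + ennreal k0
      + ennreal k2 * (\<integral>\<^sup>+\<omega>. ennreal (dist (fst (snd \<omega>)) (snd (snd \<omega>)) powr p) \<partial>\<Gamma>)"
    by (simp add: nn_integral_add nn_integral_cmult G.emeasure_space_1)
  also have "(\<integral>\<^sup>+\<omega>. ennreal (dist (fst (fst \<omega>)) (snd (fst \<omega>)) powr p) \<partial>\<Gamma>) = cost p \<pi>1"
    unfolding cost_def \<Gamma>(2)[symmetric] by (subst nn_integral_distr) simp_all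
  also have "(\<integral>\<^sup>+\<omega>. ennreal (dist (fst (snd \<omega>)) (snd (snd \<omega>)) powr p) \<partial>\<Gamma>) = cost p \<pi>2"
    unfolding cost_def \<Gamma>(3)[symmetric] by (subst nn_integral_distr) simp_all
  also have "ennreal k1 * cost p \<pi>1 + ennreal k0 + ennreal k2 * cost p \<pi>2
      \<le> ennreal k1 * ennreal (A powr p) + ennreal k0 + ennreal k2 * ennreal (B powr p)"
    using \<pi>1(2) \<pi>2(2) by (intro add_mono mult_left_mono) auto
  also have "\<dots> = ennreal (k1 * A powr p + k0 + k2 * B powr p)"
    using k by (simp add: ennreal_mult'[symmetric] ennreal_plus[symmetric] del: ennreal_plus)
  also have "k1 * A powr p + k0 + k2 * B powr p = S powr p"
  proof -
    have "k1 * A powr p + k0 + k2 * B powr p = S powr p * ((A + r + B) / S)"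
      unfolding k1_def k0_def k2_def using pos by (simp add: field_simps)
    then show ?thesis using pos by (simp add: S_def)
  qed
  finally have "Wp p \<mu> \<xi> \<le> S" using \<pi> pos by (intro Wp_le) auto
  then show "Wp p \<mu> \<xi> \<le> Wp p \<mu> \<nu> + Wp p \<nu> \<xi> + e" using SS by simp
qed

section \<open>Curves of maximal slope\<close>

lemma AE_lborel_exists:
  fixes a b :: real
  assumes "AE x in lborel. P x" "a < b"
  obtains x where "a < x" "x < b" "P x"
proof -
  have "\<exists>x\<in>{a<..<b}. P x"
  proof (rule ccontr)
    assume *: "\<not> ?thesis"
    have "AE x in lborel. x \<notin> {a<..<b}" using assms(1) by eventually_elim (use * in auto)
    then have "{a<..<b} \<in> null_sets lborel" by (subst AE_iff_null_sets) auto
    then show False using assms(2) by (simp add: null_sets_def)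
  qed
  then show ?thesis using that by auto
qed

text \<open>The two bounds serve different ends: the integrable \<open>m\<close> pays for null sets
  of times in \<open>subadditive_AE_bound\<close>, while the continuous primitive \<open>F\<close>
  bounds the variation and gives continuity of the curve.\<close>

lemma AC_modulus:
  assumes p: "0 < p" and ac: "AC p \<rho>" and "0 < T"
  obtains m F where "set_integrable lborel {0..T} m" "continuous_on {0..T} F"
    "\<And>s t. \<lbrakk>0 \<le> s; s \<le> t; t \<le> T\<rbrakk> \<Longrightarrow> Wp p (\<rho> s) (\<rho> t) \<le> (LINT r:{s..t}|lborel. m r)"
    "\<And>s t. \<lbrakk>0 \<le> s; s \<le> t; t \<le> T\<rbrakk> \<Longrightarrow> Wp p (\<rho> s) (\<rho> t) \<le> F t - F s"
proof -
  have "ACT p T \<rho>" using ac \<open>0 < T\<close> unfolding AC_def by blast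
  then obtain m where m: "set_integrable lborel {0..T} m"
    and le: "\<And>s t. 0 \<le> s \<and> s < t \<and> t \<le> T \<Longrightarrow> Wp p (\<rho> t) (\<rho> s) \<le> (LINT r:{s..t}|lborel. m r)"
    unfolding ACT_def by blast
  define F where "F t = integral {0..t} m" for t
  have sub: "set_integrable lborel {s..t} m" if "0 \<le> s" "t \<le> T" for s t
    by (rule set_integrable_subset[OF m]) (use that in auto)
  have int: "m integrable_on {s..t}" "(LINT r:{s..t}|lborel. m r) = integral {s..t} m" if "0 \<le> s" "t \<le> T" for s t
    using set_borel_integral_eq_integral[OF sub[OF that]] by auto
  have F: "F t - F s = integral {s..t} m" if "0 \<le> s" "s \<le> t" "t \<le> T" for s t
    using Henstock_Kurzweil_Integration.integral_combine[of 0 s t m] int(1)[of 0 t] that unfolding F_def by auto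
  have *: "Wp p (\<rho> s) (\<rho> t) \<le> integral {s..t} m" if "0 \<le> s" "s \<le> t" "t \<le> T" for s t
  proof (cases "s = t")
    case True
    have "\<rho> t \<in> Prob" using ac that unfolding AC_def by (meson Pp_imp_Prob order_trans)
    then show ?thesis using True Wp_self[OF p, of "\<rho> t"] by simp
  next
    case False
    then show ?thesis using le[of s t] int(2)[of s t] that by (simp add: Wp_commute[of p "\<rho> s"])
  qed
  have "continuous_on {0..T} F" unfolding F_def
    using indefinite_integral_continuous_1[of m 0 T] int(1)[of 0 T] by auto
  then show ?thesis using that[of m F] m * F int(2) by auto
qed

text \<open>Only through this does the \<open>Lim\<close> in \<open>metric_deriv\<close> acquire its
  intended value. The differentiation theorem works on bounded intervals, so the half-line is
  exhausted by countably many of them.\<close>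

lemma AE_metric_deriv_limit:
  assumes p: "1 < p" and ac: "AC p \<rho>"
  shows "AE t in lborel. 0 < t \<longrightarrow> ((\<lambda>s. Wp p (\<rho> t) (\<rho> s) / \<bar>t - s\<bar>) \<longlongrightarrow> metric_deriv p \<rho> t) (at t)"
proof -
  have "AE t in lborel. t \<in> {0<..<real (Suc n)} \<longrightarrow> (\<exists>L. ((\<lambda>s. Wp p (\<rho> t) (\<rho> s) / \<bar>t - s\<bar>) \<longlongrightarrow> L) (at t))" for n
  proof -
    obtain m F where F: "\<And>s t. \<lbrakk>0 \<le> s; s \<le> t; t \<le> real (Suc n)\<rbrakk> \<Longrightarrow> Wp p (\<rho> s) (\<rho> t) \<le> F t - F s"
      using AC_modulus[OF _ ac, of "real (Suc n)"] p by (metis less_trans of_nat_0_less_iff zero_less_Suc zero_less_one)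
    interpret bv_pseudometric "\<lambda>s t. Wp p (\<rho> s) (\<rho> t)" F 0 "real (Suc n)"
    proof
      show "Wp p (\<rho> s) (\<rho> u) \<le> Wp p (\<rho> s) (\<rho> t) + Wp p (\<rho> t) (\<rho> u)"
        if "0 \<le> s" "s \<le> t" "t \<le> u" "u \<le> real (Suc n)" for s t u
        using that ac p unfolding AC_def by (intro Wp_triangle) auto
    qed (use F in \<open>auto simp: Wp_nonneg intro: Wp_commute\<close>)
    show ?thesis using AE_metric_derivative_exists unfolding AE_completion_iff .
  qed
  then have "AE t in lborel. \<forall>n. t \<in> {0<..<real (Suc n)} \<longrightarrow> (\<exists>L. ((\<lambda>s. Wp p (\<rho> t) (\<rho> s) / \<bar>t - s\<bar>) \<longlongrightarrow> L) (at t))"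
    unfolding AE_all_countable by (rule allI)
  then show ?thesis
  proof eventually_elim
    case (elim t)
    show ?case
    proof
      assume t: "0 < t"
      obtain n where "t < real n" using reals_Archimedean2 by blast
      then have "t < real (Suc n)" by simp
      then obtain L where L: "((\<lambda>s. Wp p (\<rho> t) (\<rho> s) / \<bar>t - s\<bar>) \<longlongrightarrow> L) (at t)" using elim t by auto
      have "at t within {0..} = at t" using t by (intro at_within_interior) (simp add: interior_real_atLeast)
      then have "metric_deriv p \<rho> t = L" unfolding metric_deriv_def using L by (simp add: tendsto_Lim)
      then show "((\<lambda>s. Wp p (\<rho> t) (\<rho> s) / \<bar>t - s\<bar>) \<longlongrightarrow> metric_deriv p \<rho> t) (at t)" using L by simp
    qed
  qed
qed

text \<open>Turns a limit of difference quotients into the local hypothesis of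
  \<open>subadditive_AE_bound\<close>; \<open>min\<close> and \<open>max\<close> treat points on
  both sides of \<open>x\<close> at once.\<close>

lemma difference_quotient_limit_imp_local_bound:
  fixes D :: "real \<Rightarrow> real \<Rightarrow> real"
  assumes lim: "(q \<longlongrightarrow> L) (at x)" and "L < e"
    and D: "\<And>u. u \<in> S \<Longrightarrow> u \<noteq> x \<Longrightarrow> D (min u x) (max u x) = \<bar>u - x\<bar> * q u" and "D x x \<le> 0"
  shows "\<exists>\<delta>>0. \<forall>u\<in>S. \<bar>u - x\<bar> < \<delta> \<longrightarrow> D (min u x) (max u x) \<le> e * \<bar>u - x\<bar>"
proof -
  have "\<forall>\<^sub>F u in at x. q u < e" using order_tendstoD(2)[OF lim \<open>L < e\<close>] .
  then obtain \<delta> where \<delta>: "0 < \<delta>" "\<And>u. u \<noteq> x \<Longrightarrow> dist u x < \<delta> \<Longrightarrow> q u < e"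
    unfolding eventually_at by auto
  have "D (min u x) (max u x) \<le> e * \<bar>u - x\<bar>" if "u \<in> S" "\<bar>u - x\<bar> < \<delta>" for u
  proof (cases "u = x")
    case False
    then have "q u \<le> e" using \<delta>(2)[of u] that by (simp add: dist_real_def)
    then show ?thesis using D[OF that(1) False] by (simp add: mult_left_mono mult.commute[of e])
  qed (use assms(4) in simp)
  then show ?thesis using \<delta>(1) by blast
qed

text \<open>The second term matters only for \<open>v\<close> above \<eta>, where
  \<open>v powr (1 - p)\<close> is at most \<open>\<eta> powr (1 - p)\<close>. The free \<eta> can
  be made small before the energy drop has to compensate for the large factor.\<close>

lemma le_powr_young:
  fixes v \<eta> p :: real
  assumes "0 \<le> v" "0 < \<eta>" "1 < p"
  shows "v \<le> \<eta> + \<eta> powr (1 - p) * v powr p"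
proof (cases "v \<le> \<eta>")
  case False
  then have "v = v powr (1 - p) * v powr p" using assms by (simp add: powr_add[symmetric])
  also have "\<dots> \<le> \<eta> powr (1 - p) * v powr p"
    using False assms by (intro mult_right_mono powr_mono2') auto
  finally show ?thesis using assms by simp
qed (simp add: add_increasing2)

section \<open>Estimates along a curve of maximal slope\<close>

text \<open>A curve of maximal slope seen from a time \<open>t0\<close> on at which its energy
  function is already finite; at time 0 it may be infinite. This allows a real-valued
  \<open>f\<close>, and \<open>t0 > 0\<close> allows two-sided derivatives.\<close>

locale slope_curve =
  fixes p :: real and E :: "'a::polish_space measure \<Rightarrow> ereal" and G :: "'a measure \<Rightarrow> ennreal"
    and \<rho> :: "real \<Rightarrow> 'a measure" and f :: "real \<Rightarrow> real" and t0 C :: real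
  assumes p: "1 < p" and ac: "AC p \<rho>" and t0: "0 < t0"
    and antimono: "\<And>s t. \<lbrakk>t0 \<le> s; s \<le> t\<rbrakk> \<Longrightarrow> f t \<le> f s"
    and lower: "\<And>t. t0 \<le> t \<Longrightarrow> C \<le> f t"
    and energy: "AE t in lborel. t0 \<le> t \<longrightarrow> E (\<rho> t) = ereal (f t)"
    and slope: "AE t in lborel. t0 \<le> t \<longrightarrow> G (\<rho> t) < \<infinity> \<and>
      (f has_real_derivative (- (1 / p) * metric_deriv p \<rho> t powr p
        - (1 / (p / (p - 1))) * enn2real (G (\<rho> t)) powr (p / (p - 1)))) (at t)"
begin

definition dissipation :: "real \<Rightarrow> real" where
  "dissipation t = 1 / p * metric_deriv p \<rho> t powr p
    + 1 / (p / (p - 1)) * enn2real (G (\<rho> t)) powr (p / (p - 1))"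

lemma slope': "AE t in lborel. t0 \<le> t \<longrightarrow> G (\<rho> t) < \<infinity> \<and> (f has_real_derivative - dissipation t) (at t)"
  using slope unfolding dissipation_def by (simp add: algebra_simps)

lemma q_pos: "0 < p / (p - 1)"
  using p by simp

lemma metric_part_le: "1 / p * metric_deriv p \<rho> t powr p \<le> dissipation t"
  using p unfolding dissipation_def by simp

lemma slope_part_le: "1 / (p / (p - 1)) * enn2real (G (\<rho> t)) powr (p / (p - 1)) \<le> dissipation t"
  using p unfolding dissipation_def by simp

lemma Pp: "0 \<le> t \<Longrightarrow> \<rho> t \<in> Pp p"
  using ac unfolding AC_def by blast

lemma Pp': "t0 \<le> t \<Longrightarrow> \<rho> t \<in> Pp p"
  using Pp t0 by simp

text \<open>Young's inequality \<open>le_powr_young\<close> makes the speed at most \<open>\<eta>\<close> plus a multiple of \<open>- f'\<close>, so neither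
  measurability nor integrability of the metric derivative is needed.\<close>

lemma Wp_le_energy_drop:
  assumes "0 < \<eta>" "t0 \<le> s" "s \<le> t"
  shows "Wp p (\<rho> s) (\<rho> t) \<le> \<eta> * (t - s) + p * \<eta> powr (1 - p) * (f s - f t)"
proof -
  \<comment> \<open>The factor \<open>p\<close> cancels the \<open>1 / p\<close> in front of the
    metric term of \<open>dissipation\<close>.\<close>
  define K where "K = p * \<eta> powr (1 - p)"
  have K: "0 \<le> K" using p unfolding K_def by simp
  \<comment> \<open>The claim is \<open>D s t \<le> 0\<close>. The Wasserstein term is subadditive
    and the other two are additive; at almost every time the derivative of \<open>D\<close> is the
    speed minus \<eta> minus \<open>K * dissipation\<close>, nonpositive by Young's
    inequality.\<close>
  define D where "D u w = Wp p (\<rho> u) (\<rho> w) - \<eta> * (w - u) - K * (f u - f w)" for u w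
  have s0: "0 < s" "0 < t" using assms t0 by auto
  obtain m F where m: "set_integrable lborel {0..t} m"
    and Wm: "\<And>u w. \<lbrakk>0 \<le> u; u \<le> w; w \<le> t\<rbrakk> \<Longrightarrow> Wp p (\<rho> u) (\<rho> w) \<le> (LINT r:{u..w}|lborel. m r)"
    using AC_modulus[OF _ ac s0(2)] p by (metis less_trans zero_less_one)
  \<comment> \<open>The limit of the quotients is only known to be at most 0, but a local bound
    needs a strict inequality; the slack \<open>e\<close> is removed afterwards.\<close>
  have "D s t \<le> e * (t - s)" if "0 < e" for e
  proof (rule subadditive_AE_bound[where D = D and m = m])
    show "D u w \<le> D u x + D x w" if "s \<le> u" "u \<le> x" "x \<le> w" "w \<le> t" for u x w
      using Wp_triangle[of p "\<rho> u" "\<rho> x" "\<rho> w"] p Pp[of u] Pp[of x] Pp[of w] that s0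
      unfolding D_def by (simp add: algebra_simps)
    show "set_integrable lborel {s..t} m"
      by (rule set_integrable_subset[OF m]) (use s0 in auto)
    show "D u w \<le> (LINT r:{u..w}|lborel. m r)" if "s \<le> u" "u \<le> w" "w \<le> t" for u w
    proof -
      have "0 \<le> \<eta> * (w - u)" "0 \<le> K * (f u - f w)"
        using K assms that antimono[of u w] by auto
      then show ?thesis using Wm[of u w] that s0 unfolding D_def by linarith
    qed
    show "AE x in lborel. x \<in> {s..t} \<longrightarrow>
      (\<exists>\<delta>>0. \<forall>u\<in>{s..t}. \<bar>u - x\<bar> < \<delta> \<longrightarrow> D (min u x) (max u x) \<le> e * \<bar>u - x\<bar>)"
      using AE_metric_deriv_limit[OF p ac] slope'
    proof eventually_elim
      case (elim x)
      show ?case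
      proof
        assume x: "x \<in> {s..t}"
        define v where "v = metric_deriv p \<rho> x"
        define q where "q u = Wp p (\<rho> x) (\<rho> u) / \<bar>x - u\<bar> - \<eta> + K * ((f u - f x) / (u - x))" for u
        have lim: "((\<lambda>u. Wp p (\<rho> x) (\<rho> u) / \<bar>x - u\<bar>) \<longlongrightarrow> v) (at x)"
          using elim(1) x s0 unfolding v_def by auto
        have "((\<lambda>u. (f u - f x) / (u - x)) \<longlongrightarrow> - dissipation x) (at x)"
          using elim(2) x assms unfolding has_field_derivative_iff by auto
        with lim have qlim: "(q \<longlongrightarrow> v - \<eta> + K * - dissipation x) (at x)"
          unfolding q_def by (intro tendsto_intros)
        have "0 \<le> v" by (rule tendsto_lowerbound[OF lim]) (auto simp: Wp_nonneg intro!: always_eventually)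
        then have "v \<le> \<eta> + \<eta> powr (1 - p) * v powr p" using assms p by (intro le_powr_young)
        also have "\<eta> powr (1 - p) * v powr p = K * (1 / p * v powr p)" unfolding K_def using p by simp
        also have "\<dots> \<le> K * dissipation x" using K metric_part_le[of x] unfolding v_def by (intro mult_left_mono)
        finally have neg: "v - \<eta> + K * - dissipation x < e" using \<open>0 < e\<close> by simp
        show "\<exists>\<delta>>0. \<forall>u\<in>{s..t}. \<bar>u - x\<bar> < \<delta> \<longrightarrow> D (min u x) (max u x) \<le> e * \<bar>u - x\<bar>"
        proof (rule difference_quotient_limit_imp_local_bound[OF qlim neg])
          fix u assume ux: "u \<noteq> x"
          define c where "c = (f u - f x) / (u - x)"
          define w where "w = Wp p (\<rho> x) (\<rho> u) / \<bar>x - u\<bar>"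
          have c: "f u - f x = (u - x) * c" and w: "Wp p (\<rho> x) (\<rho> u) = \<bar>x - u\<bar> * w"
            using ux unfolding c_def w_def by simp_all
          have q: "q u = w - \<eta> + K * c" unfolding q_def c_def w_def ..
          show "D (min u x) (max u x) = \<bar>u - x\<bar> * q u"
          proof (cases "u < x")
            case True
            then have "D (min u x) (max u x) = Wp p (\<rho> x) (\<rho> u) - \<eta> * (x - u) - K * (f u - f x)"
              unfolding D_def by (simp add: Wp_commute[of p "\<rho> x"])
            then show ?thesis unfolding q c w using True by (simp add: algebra_simps)
          next
            case False
            then have "D (min u x) (max u x) = Wp p (\<rho> x) (\<rho> u) - \<eta> * (u - x) + K * (f u - f x)"
              unfolding D_def by (simp add: min_def max_def algebra_simps)
            then show ?thesis unfolding q c w using False by (simp add: algebra_simps)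
          qed
        next
          show "D x x \<le> 0" unfolding D_def using p Pp[of x] x s0 by (simp add: Wp_self Pp_imp_Prob)
        qed
      qed
    qed
  qed (use assms \<open>0 < e\<close> in auto)
  then have bound: "D s t \<le> e * (t - s)" if "0 < e" for e using that by blast
  have "D s t \<le> 0"
  proof (rule field_le_epsilon)
    fix r :: real assume "0 < r"
    have "r / (t - s + 1) * (t - s) \<le> r" using assms \<open>0 < r\<close> by (simp add: field_simps)
    then show "D s t \<le> 0 + r" using bound[of "r / (t - s + 1)"] \<open>0 < r\<close> assms by fastforce
  qed
  then show ?thesis unfolding D_def K_def by simp
qed

text \<open>Otherwise - \<open>f'\<close> exceeds \<open>c\<close> almost everywhere on the unit
  interval. A non-increasing function drops at least by what its derivative accounts for, so the
  drop would be at least \<open>c\<close>.\<close>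

lemma exists_small_dissipation:
  assumes "t0 \<le> s" "f s - f (s + 1) < c"
  obtains t where "s \<le> t" "t \<le> s + 1" "G (\<rho> t) < \<infinity>" "dissipation t \<le> c"
proof -
  have "0 < c" using antimono[of s "s + 1"] assms by simp
  have "\<exists>t. s \<le> t \<and> t \<le> s + 1 \<and> G (\<rho> t) < \<infinity> \<and> dissipation t \<le> c"
  proof (rule ccontr)
    assume *: "\<not> ?thesis"
    define D where "D u w = c * (w - u) - (f u - f w)" for u w
    have "D s (s + 1) \<le> 0 * (s + 1 - s)"
    proof (rule subadditive_AE_bound[where D = D and m = "\<lambda>_. c"])
      show "set_integrable lborel {s..s + 1} (\<lambda>_. c)" unfolding set_integrable_def by simp
      show "D u w \<le> (LINT r:{u..w}|lborel. c)" if "s \<le> u" "u \<le> w" "w \<le> s + 1" for u w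
        using that antimono[of u w] assms unfolding D_def set_lebesgue_integral_def by (simp add: mult.commute)
      show "AE x in lborel. x \<in> {s..s + 1} \<longrightarrow>
        (\<exists>\<delta>>0. \<forall>u\<in>{s..s + 1}. \<bar>u - x\<bar> < \<delta> \<longrightarrow> D (min u x) (max u x) \<le> 0 * \<bar>u - x\<bar>)"
        using slope'
      proof eventually_elim
        case (elim x)
        show ?case
        proof
          assume x: "x \<in> {s..s + 1}"
          then have gx: "G (\<rho> x) < \<infinity>" "(f has_real_derivative - dissipation x) (at x)" using elim assms by auto
          then have neg: "c + - dissipation x < 0" using * x by (auto simp: not_le)
          have "((\<lambda>u. c + (f u - f x) / (u - x)) \<longlongrightarrow> c + - dissipation x) (at x)"
            using gx(2) unfolding has_field_derivative_iff by (intro tendsto_intros)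
          then show "\<exists>\<delta>>0. \<forall>u\<in>{s..s + 1}. \<bar>u - x\<bar> < \<delta> \<longrightarrow> D (min u x) (max u x) \<le> 0 * \<bar>u - x\<bar>"
          proof (rule difference_quotient_limit_imp_local_bound[OF _ neg])
            fix u assume ux: "u \<noteq> x"
            define k where "k = (f u - f x) / (u - x)"
            have k: "f u - f x = (u - x) * k" using ux unfolding k_def by simp
            have "D (min u x) (max u x) = \<bar>u - x\<bar> * (c + k)"
            proof (cases "u < x")
              case True
              then have "D (min u x) (max u x) = c * (x - u) - (f u - f x)" unfolding D_def by simp
              then show ?thesis unfolding k using True by (simp add: algebra_simps)
            next
              case False
              then have "D (min u x) (max u x) = c * (u - x) + (f u - f x)"
                unfolding D_def by (simp add: min_def max_def)
              then show ?thesis unfolding k using False by (simp add: algebra_simps)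
            qed
            then show "D (min u x) (max u x) = \<bar>u - x\<bar> * (c + (f u - f x) / (u - x))"
              unfolding k_def .
          qed (simp add: D_def)
        qed
      qed
    qed (auto simp: D_def algebra_simps)
    then show False using assms unfolding D_def by simp
  qed
  then show ?thesis using that by blast
qed

text \<open>The identity with \<open>f\<close> may fail at \<open>t\<close> itself. It holds at
  times \<open>s n\<close> increasing to \<open>t\<close>, along which the curve converges, so lower
  semicontinuity carries the bound over.\<close>

lemma energy_bound:
  assumes lsc: "lsc_sigma p E" and t: "t0 < t"
  shows "E (\<rho> t) \<le> ereal (f t0)"
proof -
  have "\<exists>s. max t0 (t - 1 / real (Suc n)) < s \<and> s < t \<and> (t0 \<le> s \<longrightarrow> E (\<rho> s) = ereal (f s))" for n
    using AE_lborel_exists[OF energy, of "max t0 (t - 1 / real (Suc n))" t] t by fastforce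
  then obtain s where s: "\<And>n. max t0 (t - 1 / real (Suc n)) < s n" "\<And>n. s n < t"
    "\<And>n. t0 \<le> s n \<Longrightarrow> E (\<rho> (s n)) = ereal (f (s n))" by metis
  have s0: "t0 < s n" for n using s(1)[of n] by simp
  have "s \<longlonglongrightarrow> t"
  proof (rule tendsto_sandwich[of "\<lambda>n. t - 1 / real (Suc n)" _ _ "\<lambda>_. t"])
    have "(\<lambda>n. t - 1 / real (Suc n)) \<longlonglongrightarrow> t - 0"
      by (intro tendsto_diff tendsto_const LIMSEQ_Suc[OF lim_1_over_n])
    then show "(\<lambda>n. t - 1 / real (Suc n)) \<longlonglongrightarrow> t" by simp
  qed (use s in \<open>auto intro!: always_eventually less_imp_le\<close>)
  have tpos: "0 < t" using t t0 by simp
  obtain m F where F: "continuous_on {0..t} F"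
    "\<And>u w. \<lbrakk>0 \<le> u; u \<le> w; w \<le> t\<rbrakk> \<Longrightarrow> Wp p (\<rho> u) (\<rho> w) \<le> F w - F u"
    using AC_modulus[OF _ ac tpos] p by (metis less_trans zero_less_one)
  have "(\<lambda>n. F (s n)) \<longlonglongrightarrow> F t"
    using s(2) s0 t0 tpos by (intro continuous_on_tendsto_compose[OF F(1) \<open>s \<longlonglongrightarrow> t\<close>])
      (auto intro!: always_eventually less_imp_le intro: less_trans)
  then have F0: "(\<lambda>n. F t - F (s n)) \<longlonglongrightarrow> 0" using tendsto_diff[OF tendsto_const, of "\<lambda>n. F (s n)" "F t" sequentially "F t"] by simp
  have s00: "0 \<le> s n" "s n \<le> t" for n using s0[of n] s(2)[of n] t0 by auto
  have "(\<lambda>n. Wp p (\<rho> (s n)) (\<rho> t)) \<longlonglongrightarrow> 0"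
    by (rule tendsto_sandwich[OF _ _ tendsto_const F0])
      (use F(2)[OF s00] in \<open>auto simp: Wp_nonneg intro!: always_eventually\<close>)
  then have "(\<lambda>n. dLP (\<rho> (s n)) (\<rho> t)) \<longlonglongrightarrow> 0"
    using p Pp[OF s00(1)] Pp[of t] tpos by (intro Wp_tendsto_imp_dLP_tendsto) auto
  then have "E (\<rho> t) \<le> liminf (\<lambda>n. E (\<rho> (s n)))"
    using lsc Pp[OF s00(1)] Pp[of t] tpos unfolding lsc_sigma_def by auto
  also have "\<dots> \<le> ereal (f t0)"
  proof (rule Liminf_le)
    show "\<forall>\<^sub>F n in sequentially. E (\<rho> (s n)) \<le> ereal (f t0)"
      using s(3) s0 antimono by (intro always_eventually allI) (metis ereal_less_eq(3) less_imp_le order_refl)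
  qed simp
  finally show ?thesis .
qed

lemma drop_tendsto_0:
  assumes t: "filterlim t at_top sequentially" "\<And>n. t0 \<le> t n"
  shows "(\<lambda>n. f (t n) - f (t n + 1)) \<longlonglongrightarrow> 0"
proof -
  define L where "L = Inf (f ` {t0..})"
  have bdd: "bdd_below (f ` {t0..})" using lower by (auto intro!: bdd_belowI[of _ C])
  have L: "L \<le> f s" if "t0 \<le> s" for s unfolding L_def using that by (intro cInf_lower[OF _ bdd]) auto
  have "(f \<longlongrightarrow> L) at_top"
  proof (rule order_tendstoI)
    fix a assume "a < L"
    then show "\<forall>\<^sub>F s in at_top. a < f s"
      using L by (auto intro!: eventually_mono[OF eventually_ge_at_top[of t0]] intro: less_le_trans)
  next
    fix a assume "L < a"
    then obtain r where r: "t0 \<le> r" "f r < a" using cInf_lessD[of "f ` {t0..}" a] unfolding L_def by auto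
    show "\<forall>\<^sub>F s in at_top. f s < a"
      using r antimono by (auto intro!: eventually_mono[OF eventually_ge_at_top[of r]] intro: le_less_trans)
  qed
  moreover have "filterlim (\<lambda>n. t n + 1) at_top sequentially"
    by (rule filterlim_at_top_mono[OF t(1)]) auto
  ultimately have "(\<lambda>n. f (t n)) \<longlonglongrightarrow> L" "(\<lambda>n. f (t n + 1)) \<longlonglongrightarrow> L"
    using t(1) filterlim_compose by blast+
  then show ?thesis using tendsto_diff by fastforce
qed

lemma limit_point_slope_zero:
  assumes lsc: "lsc_sigma p G" and t: "filterlim t at_top sequentially" "\<And>n. t0 \<le> t n"
    and l: "l \<in> Pp p" "(\<lambda>n. dLP (\<rho> (t n)) l) \<longlonglongrightarrow> 0"
  shows "G l = 0"
proof -
  define \<epsilon> where "\<epsilon> n = f (t n) - f (t n + 1)" for n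
  have \<epsilon>: "\<epsilon> \<longlonglongrightarrow> 0" unfolding \<epsilon>_def by (rule drop_tendsto_0[OF t])
  \<comment> \<open>The added \<open>1 / real (Suc n)\<close> makes the inequality required by
    \<open>exists_small_dissipation\<close> strict even when the energy does not drop.\<close>
  define c where "c n = \<epsilon> n + 1 / real (Suc n)" for n
  have c: "c \<longlonglongrightarrow> 0" unfolding c_def using tendsto_add[OF \<epsilon> LIMSEQ_Suc[OF lim_1_over_n]] by simp
  have "\<exists>s. t n \<le> s \<and> s \<le> t n + 1 \<and> G (\<rho> s) < \<infinity> \<and> dissipation s \<le> c n" for n
  proof -
    have "f (t n) - f (t n + 1) < c n" unfolding c_def \<epsilon>_def by simp
    then show ?thesis using exists_small_dissipation[OF t(2)[of n]] by metis
  qed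
  then obtain s where s: "\<And>n. t n \<le> s n" "\<And>n. s n \<le> t n + 1" "\<And>n. G (\<rho> (s n)) < \<infinity>" "\<And>n. dissipation (s n) \<le> c n"
    by metis
  have st0: "t0 \<le> s n" for n using s(1)[of n] t(2)[of n] by simp
  have "(\<lambda>n. Wp p (\<rho> (s n)) (\<rho> (t n))) \<longlonglongrightarrow> 0"
  proof (rule LIMSEQ_I)
    fix r :: real assume "0 < r"
    \<comment> \<open>With \<eta> fixed first, \<open>K\<close> is independent of \<open>n\<close>.
      A time step of length at most 1 costs at most \<open>r / 2\<close>, and the remaining term
      \<open>K * \<epsilon> n\<close> tends to 0.\<close>
    define \<eta> where "\<eta> = r / 2"
    define K where "K = p * \<eta> powr (1 - p)"
    have \<eta>: "0 < \<eta>" "\<eta> < r" using \<open>0 < r\<close> unfolding \<eta>_def by auto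
    have "(\<lambda>n. K * \<epsilon> n) \<longlonglongrightarrow> 0" using tendsto_mult_right_zero[OF \<epsilon>, of K] by simp
    then obtain N where N: "\<And>n. n \<ge> N \<Longrightarrow> norm (K * \<epsilon> n - 0) < r / 2"
      using LIMSEQ_D[of "\<lambda>n. K * \<epsilon> n" 0 "r / 2"] \<open>0 < r\<close> by auto
    have "norm (Wp p (\<rho> (s n)) (\<rho> (t n)) - 0) < r" if "n \<ge> N" for n
    proof -
      have "Wp p (\<rho> (t n)) (\<rho> (s n)) \<le> \<eta> * (s n - t n) + K * (f (t n) - f (s n))"
        unfolding K_def using \<eta> t(2) s(1) by (intro Wp_le_energy_drop)
      also have "\<dots> \<le> \<eta> * 1 + K * \<epsilon> n"
        using \<eta> p s(2)[of n] st0[of n] antimono[of "s n" "t n + 1"] unfolding K_def \<epsilon>_def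
        by (intro add_mono mult_left_mono) auto
      also have "\<dots> < r" using N[OF that] unfolding \<eta>_def by (simp add: abs_less_iff)
      finally show ?thesis by (simp add: Wp_commute[of p "\<rho> (s n)"] Wp_nonneg abs_of_nonneg)
    qed
    then show "\<exists>N. \<forall>n\<ge>N. norm (Wp p (\<rho> (s n)) (\<rho> (t n)) - 0) < r" by blast
  qed
  then have d1: "(\<lambda>n. dLP (\<rho> (s n)) (\<rho> (t n))) \<longlonglongrightarrow> 0"
    using p Pp'[OF st0] Pp'[OF t(2)] by (intro Wp_tendsto_imp_dLP_tendsto) auto
  have "(\<lambda>n. dLP (\<rho> (s n)) l) \<longlonglongrightarrow> 0"
  proof (rule tendsto_sandwich[OF _ _ tendsto_const])
    show "(\<lambda>n. dLP (\<rho> (s n)) (\<rho> (t n)) + dLP (\<rho> (t n)) l) \<longlonglongrightarrow> 0" using tendsto_add[OF d1 l(2)] by simp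
  qed (use Pp'[OF st0] Pp'[OF t(2)] l(1) in \<open>auto intro!: always_eventually dLP_nonneg dLP_triangle intro: Pp_imp_Prob\<close>)
  then have "G l \<le> liminf (\<lambda>n. G (\<rho> (s n)))"
    using lsc Pp'[OF st0] l(1) unfolding lsc_sigma_def by auto
  also have "\<dots> = 0"
  proof (rule lim_imp_Liminf[OF sequentially_bot])
    define q where "q = p / (p - 1)"
    define g where "g n = enn2real (G (\<rho> (s n)))" for n
    have q: "0 < q" unfolding q_def by (rule q_pos)
    \<comment> \<open>Invert the slope part of the dissipation by taking the \<open>q\<close>-th
      root.\<close>
    have gle: "g n \<le> (q * c n) powr (1 / q)" for n
    proof -
      have "1 / q * g n powr q \<le> c n"
        using slope_part_le[of "s n"] s(4)[of n] unfolding g_def q_def by linarith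
      then have "g n powr q \<le> q * c n" using q by (simp add: field_simps)
      then have "(g n powr q) powr (1 / q) \<le> (q * c n) powr (1 / q)" using q by (intro powr_mono2) auto
      then show ?thesis using q by (simp add: powr_powr g_def)
    qed
    have lim: "(\<lambda>n. (q * c n) powr (1 / q)) \<longlonglongrightarrow> 0"
    proof (rule tendsto_zero_powrI[where b = "1 / q"])
      show "(\<lambda>n. q * c n) \<longlonglongrightarrow> 0" using tendsto_mult_right_zero[OF c, of q] by simp
      have "0 \<le> c n" for n using antimono[of "t n" "t n + 1"] t(2) unfolding c_def \<epsilon>_def by (simp add: add_nonneg_nonneg)
      then show "\<forall>\<^sub>F n in sequentially. 0 \<le> q * c n" using q by (intro always_eventually) auto
    qed (use q in auto)
    have "g \<longlonglongrightarrow> 0"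
    proof (rule tendsto_sandwich[OF _ _ tendsto_const lim])
      show "\<forall>\<^sub>F n in sequentially. 0 \<le> g n" unfolding g_def by simp
      show "\<forall>\<^sub>F n in sequentially. g n \<le> (q * c n) powr (1 / q)" using gle by simp
    qed
    then have "(\<lambda>n. ennreal (g n)) \<longlonglongrightarrow> ennreal 0" by (intro tendsto_ennrealI)
    moreover have "ennreal (g n) = G (\<rho> (s n))" for n unfolding g_def using s(3)[of n] by (simp add: less_top)
    ultimately show "(\<lambda>n. G (\<rho> (s n))) \<longlonglongrightarrow> 0" by simp
  qed
  finally show ?thesis by simp
qed

end

section \<open>Stationarity of limit points and convergence\<close>

lemma max_slope_curve_real_energy:
  assumes p: "1 < p" and curve: "max_slope_curve p E G \<rho>" and C: "\<And>\<mu>. \<mu> \<in> Pp p \<Longrightarrow> ereal C \<le> E \<mu>"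
  obtains f t0 where "slope_curve p E G \<rho> f t0 C"
proof -
  obtain \<phi> where ac: "AC p \<rho>" and e: "AE t in lborel. t \<ge> 0 \<longrightarrow> E (\<rho> t) = \<phi> t" and am: "antimono_on {0..} \<phi>"
    and d: "AE t in lborel. t \<ge> 0 \<longrightarrow>
          \<phi> t \<noteq> \<infinity> \<and> G (\<rho> t) < \<infinity> \<and>
          ((\<lambda>s. real_of_ereal (\<phi> s)) has_real_derivative
             (- (1 / p) * metric_deriv p \<rho> t powr p
              - (1 / (p / (p - 1))) * enn2real (G (\<rho> t)) powr (p / (p - 1)))) (at t within {0..})"
    using curve unfolding max_slope_curve_def by blast
  obtain t0 where t0: "0 < t0" "\<phi> t0 \<noteq> \<infinity>" using AE_lborel_exists[OF d, of 0 1] by auto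
  have am: "\<phi> t \<le> \<phi> s" if "0 \<le> s" "s \<le> t" for s t
    using am that by (auto simp: monotone_on_def)
  \<comment> \<open>The lower bound on E is known for \<phi> only where the two agree; monotonicity
    pulls it back from such a time \<open>s\<close> after \<open>t\<close>.\<close>
  have low: "ereal C \<le> \<phi> t" if "0 \<le> t" for t
  proof -
    obtain s where s: "t < s" "s \<ge> 0 \<longrightarrow> E (\<rho> s) = \<phi> s" using AE_lborel_exists[OF e, of t "t + 1"] by auto
    have "\<rho> s \<in> Pp p" using ac s that unfolding AC_def by auto
    then have "ereal C \<le> \<phi> s" using C s that by fastforce
    then show ?thesis using am[of t s] that s by auto
  qed
  define f where "f t = real_of_ereal (\<phi> t)" for t
  have f: "\<phi> t = ereal (f t)" if "t0 \<le> t" for t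
  proof -
    have "\<phi> t \<noteq> \<infinity>" "\<phi> t \<noteq> - \<infinity>" using am[of t0 t] low[of t] t0 that by auto
    then show ?thesis unfolding f_def by (cases "\<phi> t") auto
  qed
  have "slope_curve p E G \<rho> f t0 C"
  proof
    show "f t \<le> f s" if "t0 \<le> s" "s \<le> t" for s t using am[of s t] f[of s] f[of t] t0 that by auto
    show "C \<le> f t" if "t0 \<le> t" for t using low[of t] f[of t] t0 that by auto
    show "AE t in lborel. t0 \<le> t \<longrightarrow> E (\<rho> t) = ereal (f t)" using e by eventually_elim (use f t0 in auto)
    show "AE t in lborel. t0 \<le> t \<longrightarrow> G (\<rho> t) < \<infinity> \<and>
      (f has_real_derivative (- (1 / p) * metric_deriv p \<rho> t powr p
        - (1 / (p / (p - 1))) * enn2real (G (\<rho> t)) powr (p / (p - 1)))) (at t)"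
      using d
    proof eventually_elim
      case (elim t)
      show ?case
      proof
        assume t: "t0 \<le> t"
        then have "at t within {0..} = at t" using t0 by (intro at_within_interior) (simp add: interior_real_atLeast)
        then show "G (\<rho> t) < \<infinity> \<and> (f has_real_derivative (- (1 / p) * metric_deriv p \<rho> t powr p
          - (1 / (p / (p - 1))) * enn2real (G (\<rho> t)) powr (p / (p - 1)))) (at t)"
          using elim t t0 unfolding f_def by auto
      qed
    qed
  qed (use p ac t0 in auto)
  then show ?thesis by (rule that)
qed

lemma zero_slope_imp_stationary:
  assumes p: "1 < p" and l: "l \<in> Pp p" "\<bar>E l\<bar> \<noteq> \<infinity>" "G l = 0"
  shows "l \<in> stationary p E G"
proof -
  have W: "Wp p l l = 0" using p l by (intro Wp_self) (auto simp: Pp_imp_Prob)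
  have ac: "AC p (\<lambda>_. l)" unfolding AC_def ACT_def using l W
    by (auto intro!: exI[of _ "\<lambda>_. 0"] simp: set_integrable_def set_lebesgue_integral_def)
  have md: "metric_deriv p (\<lambda>_. l) t = 0" if "0 \<le> t" for t
  proof -
    \<comment> \<open>\<open>Lim\<close> is determined only along a nontrivial filter; approach from
      the right is available at every \<open>t\<close>, including 0.\<close>
    have "at_right t \<le> at t within {0..}" using that by (intro at_le) auto
    then have "at t within {0..} \<noteq> bot" using trivial_limit_at_right_real[of t] by (metis bot.extremum_uniqueI)
    then show ?thesis unfolding metric_deriv_def by (intro tendsto_Lim) (auto simp: W)
  qed
  have "max_slope_curve p E G (\<lambda>_. l)" unfolding max_slope_curve_def
  proof (intro conjI exI[of _ "\<lambda>_. E l"] AE_I2 impI ac)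
    show "antimono_on {0..} (\<lambda>_. E l)" by (simp add: monotone_on_def)
    fix t :: real assume "0 \<le> t"
    then show "((\<lambda>s. real_of_ereal (E l)) has_real_derivative
             (- (1 / p) * metric_deriv p (\<lambda>_. l) t powr p
              - (1 / (p / (p - 1))) * enn2real (G l) powr (p / (p - 1)))) (at t within {0..})"
      using md l by simp
  qed (use l in auto)
  then show ?thesis unfolding stationary_def using l by auto
qed

text \<open>If the distance stayed above \<open>a\<close> along times tending to infinity,
  compactness would give a limit point, which lies in \<open>S\<close> and is approached to within
  less than \<open>a\<close>. Since \<open>S\<close> is any set containing the limit points, the
  lemma serves both for the stationary states and for their intersection with
  \<open>Y\<close>.\<close>

lemma dLP_set_tendsto_0:
  fixes \<rho> :: "real \<Rightarrow> 'a::polish_space measure"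
  assumes Pp: "\<And>t. 0 \<le> t \<Longrightarrow> \<rho> t \<in> Pp p" and A: "A \<subseteq> Pp p" "\<And>t. T < t \<Longrightarrow> \<rho> t \<in> A" and cpt: "rel_compact_sigma p A"
    and lim: "\<And>t l. \<lbrakk>filterlim t at_top sequentially; \<And>n. T < t n; l \<in> Pp p; (\<lambda>n. dLP (\<rho> (t n)) l) \<longlonglongrightarrow> 0\<rbrakk> \<Longrightarrow> l \<in> S"
  shows "((\<lambda>t. dLP_set (\<rho> t) S) \<longlongrightarrow> 0) at_top"
proof (rule order_tendstoI)
  fix a :: ennreal assume a: "0 < a"
  show "\<forall>\<^sub>F t in at_top. dLP_set (\<rho> t) S < a"
  proof (rule ccontr)
    assume "\<not> ?thesis"
    then have "\<forall>N. \<exists>t>N. a \<le> dLP_set (\<rho> t) S" unfolding eventually_at_top_dense by (meson not_less)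
    then have "\<exists>t. max T (real n) < t \<and> a \<le> dLP_set (\<rho> t) S" for n :: nat by blast
    then obtain t where t: "\<And>n::nat. max T (real n) < t n" "\<And>n. a \<le> dLP_set (\<rho> (t n)) S" by metis
    have tT: "T < t n" for n using t(1)[of n] by simp
    have t_top: "filterlim t at_top sequentially"
      by (rule filterlim_at_top_mono[OF filterlim_real_sequentially]) (use t(1) in \<open>auto intro!: always_eventually less_imp_le\<close>)
    have inA: "\<forall>n. \<rho> (t n) \<in> A" using A(2) tT by blast
    have "\<exists>l\<in>Pp p. \<exists>r. strict_mono r \<and> (\<lambda>n. dLP (\<rho> (t (r n))) l) \<longlonglongrightarrow> 0"
      using cpt[unfolded rel_compact_sigma_def, THEN conjunct2, THEN spec[of _ "\<lambda>n. \<rho> (t n)"]] inA by simp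
    then obtain l r where l: "l \<in> Pp p" "strict_mono r" "(\<lambda>n. dLP (\<rho> (t (r n))) l) \<longlonglongrightarrow> 0"
      by blast
    have "l \<in> S"
      by (rule lim[OF filterlim_compose[OF t_top filterlim_subseq[OF l(2)]] tT l(1,3)])
    have "(\<lambda>n. ennreal (dLP (\<rho> (t (r n))) l)) \<longlonglongrightarrow> ennreal 0" using l(3) by (intro tendsto_ennrealI)
    then have "\<forall>\<^sub>F n in sequentially. ennreal (dLP (\<rho> (t (r n))) l) < a" using a by (intro order_tendstoD(2)) auto
    then obtain n where "ennreal (dLP (\<rho> (t (r n))) l) < a" by (auto simp: eventually_sequentially)
    moreover have "dLP_set (\<rho> (t (r n))) S \<le> ennreal (dLP (\<rho> (t (r n))) l)"
      unfolding dLP_set_def using \<open>l \<in> S\<close> by (rule INF_lower)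
    ultimately show False using t(2)[of "r n"] by auto
  qed
qed simp

theorem theorem2p16:
  fixes p :: real
    and E :: "'a::polish_space measure \<Rightarrow> ereal"
    and G :: "'a measure \<Rightarrow> ennreal"
  assumes p: "1 < p"
    and proper: "\<forall>\<mu>\<in>Pp p. E \<mu> \<noteq> -\<infinity>" "\<exists>\<mu>\<in>Pp p. E \<mu> < \<infinity>"
    and bdd_below: "\<exists>C::real. \<forall>\<mu>\<in>Pp p. ereal C \<le> E \<mu>"
    and E_lsc: "lsc_sigma p E"
    and wug: "weak_upper_gradient p E G"
    and G_lsc: "lsc_sigma p G"
    and exist: "\<forall>\<rho>0\<in>ZE p E. \<exists>\<rho>. max_slope_curve p E G \<rho> \<and> \<rho> 0 = \<rho>0"
  shows "\<forall>\<rho>. max_slope_curve p E G \<rho> \<and> \<rho> 0 \<in> ZE p E \<longrightarrow>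
      (((\<forall>C::real. rel_compact_sigma p {\<mu>\<in>Pp p. E \<mu> \<le> ereal C}) \<or>
        (\<exists>Y. Y \<subseteq> Pp p \<and> (\<forall>t\<ge>0. \<rho> t \<in> Y) \<and> (\<forall>C::real. rel_compact_sigma p {\<mu>\<in>Pp p \<inter> Y. E \<mu> \<le> ereal C})))
         \<longrightarrow> ((\<lambda>t. dLP_set (\<rho> t) (stationary p E G)) \<longlongrightarrow> 0) at_top)
    \<and> (\<forall>Y. Y \<subseteq> Pp p \<and> (\<forall>t\<ge>0. \<rho> t \<in> Y) \<and> (\<forall>C::real. rel_compact_sigma p {\<mu>\<in>Pp p \<inter> Y. E \<mu> \<le> ereal C})
          \<and> closed_sigma p Y
         \<longrightarrow> ((\<lambda>t. dLP_set (\<rho> t) (stationary p E G \<inter> Y)) \<longlongrightarrow> 0) at_top)"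
proof (intro allI impI, elim conjE)
  fix \<rho> assume curve: "max_slope_curve p E G \<rho>"
  obtain C where C: "\<And>\<mu>. \<mu> \<in> Pp p \<Longrightarrow> ereal C \<le> E \<mu>" using bdd_below by blast
  obtain f t0 where "slope_curve p E G \<rho> f t0 C" using max_slope_curve_real_energy[OF p curve C] .
  then interpret slope_curve p E G \<rho> f t0 C .
  have stat: "l \<in> stationary p E G"
    if t: "filterlim t at_top sequentially" "\<And>n. t0 < t n" and l: "l \<in> Pp p" "(\<lambda>n. dLP (\<rho> (t n)) l) \<longlonglongrightarrow> 0" for t l
  proof (rule zero_slope_imp_stationary[OF p l(1)])
    show "G l = 0" using t l by (intro limit_point_slope_zero[OF G_lsc t(1)]) (auto intro: less_imp_le)
    have "E l \<le> liminf (\<lambda>n. E (\<rho> (t n)))"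
      using E_lsc l Pp'[OF less_imp_le[OF t(2)]] unfolding lsc_sigma_def by auto
    also have "\<dots> \<le> ereal (f t0)"
      using energy_bound[OF E_lsc t(2)] by (intro Liminf_le) auto
    finally show "\<bar>E l\<bar> \<noteq> \<infinity>" using C[OF l(1)] by auto
  qed
  \<comment> \<open>Both compactness assumptions take this form, the one without \<open>Y\<close>
    being the case \<open>Y = Pp p\<close>. The energy sublevel at \<open>f t0\<close> contains the
    curve after \<open>t0\<close>.\<close>
  have main: "((\<lambda>t. dLP_set (\<rho> t) S) \<longlongrightarrow> 0) at_top"
    if Y: "\<forall>t\<ge>0. \<rho> t \<in> Y" "\<forall>C::real. rel_compact_sigma p {\<mu>\<in>Pp p \<inter> Y. E \<mu> \<le> ereal C}"
      and S: "\<And>t l. \<lbrakk>filterlim t at_top sequentially; \<And>n. t0 < t n; l \<in> Pp p; (\<lambda>n. dLP (\<rho> (t n)) l) \<longlonglongrightarrow> 0\<rbrakk> \<Longrightarrow> l \<in> S"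
    for Y S
  proof (rule dLP_set_tendsto_0[OF Pp])
    show "rel_compact_sigma p {\<mu>\<in>Pp p \<inter> Y. E \<mu> \<le> ereal (f t0)}" using Y(2) by blast
    show "\<rho> t \<in> {\<mu>\<in>Pp p \<inter> Y. E \<mu> \<le> ereal (f t0)}" if "t0 < t" for t
      using that Y(1) Pp[of t] energy_bound[OF E_lsc that] t0 by auto
  qed (use S in auto)
  show "(((\<forall>C::real. rel_compact_sigma p {\<mu>\<in>Pp p. E \<mu> \<le> ereal C}) \<or>
        (\<exists>Y. Y \<subseteq> Pp p \<and> (\<forall>t\<ge>0. \<rho> t \<in> Y) \<and> (\<forall>C::real. rel_compact_sigma p {\<mu>\<in>Pp p \<inter> Y. E \<mu> \<le> ereal C})))
         \<longrightarrow> ((\<lambda>t. dLP_set (\<rho> t) (stationary p E G)) \<longlongrightarrow> 0) at_top)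
    \<and> (\<forall>Y. Y \<subseteq> Pp p \<and> (\<forall>t\<ge>0. \<rho> t \<in> Y) \<and> (\<forall>C::real. rel_compact_sigma p {\<mu>\<in>Pp p \<inter> Y. E \<mu> \<le> ereal C})
          \<and> closed_sigma p Y
         \<longrightarrow> ((\<lambda>t. dLP_set (\<rho> t) (stationary p E G \<inter> Y)) \<longlongrightarrow> 0) at_top)"
  proof (intro conjI impI allI)
    assume "(\<forall>C::real. rel_compact_sigma p {\<mu>\<in>Pp p. E \<mu> \<le> ereal C}) \<or>
        (\<exists>Y. Y \<subseteq> Pp p \<and> (\<forall>t\<ge>0. \<rho> t \<in> Y) \<and> (\<forall>C::real. rel_compact_sigma p {\<mu>\<in>Pp p \<inter> Y. E \<mu> \<le> ereal C}))"
    then obtain Y where "\<forall>t\<ge>0. \<rho> t \<in> Y" "\<forall>C::real. rel_compact_sigma p {\<mu>\<in>Pp p \<inter> Y. E \<mu> \<le> ereal C}"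
    proof
      assume "\<forall>C::real. rel_compact_sigma p {\<mu>\<in>Pp p. E \<mu> \<le> ereal C}"
      then show ?thesis using that[of "Pp p"] Pp by simp
    qed (use that in blast)
    then show "((\<lambda>t. dLP_set (\<rho> t) (stationary p E G)) \<longlongrightarrow> 0) at_top" by (rule main) (rule stat)
  next
    fix Y assume Y: "Y \<subseteq> Pp p \<and> (\<forall>t\<ge>0. \<rho> t \<in> Y) \<and> (\<forall>C::real. rel_compact_sigma p {\<mu>\<in>Pp p \<inter> Y. E \<mu> \<le> ereal C})
      \<and> closed_sigma p Y"
    show "((\<lambda>t. dLP_set (\<rho> t) (stationary p E G \<inter> Y)) \<longlongrightarrow> 0) at_top"
    proof (rule main)
      fix t l assume t: "filterlim t at_top sequentially" "\<And>n. t0 < t n"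
        and l: "l \<in> Pp p" "(\<lambda>n. dLP (\<rho> (t n)) l) \<longlonglongrightarrow> 0"
      have "\<rho> (t n) \<in> Y \<inter> Pp p" for n using t(2)[of n] t0 Y Pp[of "t n"] by auto
      then have "l \<in> Y" using Y l unfolding closed_sigma_def by (auto dest!: spec[of _ "\<lambda>n. \<rho> (t n)"] spec[of _ l])
      then show "l \<in> stationary p E G \<inter> Y" using stat[OF t l] by blast
    qed (use Y in blast)+
  qed
qed

end
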